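(* Let $n\ge1$, $\delta>0$, $\beta<n+4$, and let $f\in H^{s_1}(\mathbf{T}^n)$ and $g\in H^{s_2}(\mathbf{T}^n)$ with $s_1,s_2\in\mathbb{R}$. For $t\ge0$ let $$U(t)=(\hat f_0+\hat g_0t)+\sum_{0\ne k\in\mathbb{Z}^n}\left[\hat f_k\cos(\sqrt{-m_k}\,t)+\frac{\hat g_k}{\sqrt{-m_k}}\sin(\sqrt{-m_k}\,t)\right]e^{ik\cdot x}.$$ Then for any $t\ge0$, $U(t)\in H^s(\mathbf{T}^n)$, where $s=\min\{s_1,s_2+\theta\}$ with $\theta=\max\{0,\frac{\beta-n}{2}\}$.
   Context: For $k\in\mathbb{Z}^n$, $m_k=m^{\delta,\beta}(k)$, where for $\nu\in\mathbb{R}^n$ $$m^{\delta,\beta}(\nu)=-\|\nu\|^2\,{}_2F_3\!\left(1,\tfrac{n+2-\beta}{2};2,\tfrac{n+2}{2},\tfrac{n+4-\beta}{2};-\tfrac14\|\nu\|^2\delta^2\right),$$ ${}_2F_3(a_1,a_2;b_1,b_2,b_3;z)=\sum_{j\ge0}\frac{(a_1)_j(a_2)_j}{(b_1)_j(b_2)_j(b_3)_j}\frac{z^j}{j!}$, $(a)_j=a(a+1)\cdots(a+j-1)$. For $\beta<n+4$ one has $m_k<0$ for all $k\neq0$. $\mathbf{T}^n=\prod_{j=1}^n[0,2\pi]$ is the periodic torus; a periodic distribution $g$ is written $g=\sum_{k\in\mathbb{Z}^n}\hat g_ke^{ik\cdot x}$ with Fourier coefficients $\hat g_k$; for $q\in\mathbb{R}$,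 $H^q(\mathbf{T}^n)$ is the space of periodic distributions with $\|g\|_{H^q(\mathbf{T}^n)}^2=\sum_{k\in\mathbb{Z}^n}(1+\|k\|^2)^q|\hat g_k|^2<\infty$. *)

theory Defs
  imports "HOL-Analysis.Analysis"
begin

definition hyp2F3 :: "real \<Rightarrow> real \<Rightarrow> real \<Rightarrow> real \<Rightarrow> real \<Rightarrow> real \<Rightarrow> real" where
  "hyp2F3 a1 a2 b1 b2 b3 z =
     (\<Sum>j. (pochhammer a1 j * pochhammer a2 j) /
           (pochhammer b1 j * pochhammer b2 j * pochhammer b3 j) * (z ^ j / fact j))"

definition multiplier :: "real \<Rightarrow> real \<Rightarrow> real ^ 'n \<Rightarrow> real" where
  "multiplier \<delta> \<beta> \<nu> =
     - (norm \<nu>)\<^sup>2 *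
       hyp2F3 1 ((real CARD('n) + 2 - \<beta>) / 2)
              2 ((real CARD('n) + 2) / 2) ((real CARD('n) + 4 - \<beta>) / 2)
              (- (1 / 4) * (norm \<nu>)\<^sup>2 * \<delta>\<^sup>2)"

definition lattice_vec :: "int ^ 'n \<Rightarrow> real ^ 'n" where
  "lattice_vec k = (\<chi> i. real_of_int (k $ i))"

definition torus :: "(real ^ 'n) set" where
  "torus = cbox 0 (\<chi> i. 2 * pi)"

definition fourier_char :: "int ^ 'n \<Rightarrow> real ^ 'n \<Rightarrow> complex" where
  "fourier_char k x = cis (lattice_vec k \<bullet> x)"

definition partial_deriv :: "'n \<Rightarrow> (real ^ 'n \<Rightarrow> complex) \<Rightarrow> real ^ 'n \<Rightarrow> complex" where
  "partial_deriv i \<phi> x = frechet_derivative \<phi> (at x) (axis i 1)"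

abbreviation iter_partial :: "'n list \<Rightarrow> (real ^ 'n \<Rightarrow> complex) \<Rightarrow> real ^ 'n \<Rightarrow> complex" where
  "iter_partial is \<phi> \<equiv> foldr partial_deriv is \<phi>"

(* Smoothness: every iterated partial derivative exists and is again (totally) differentiable,
   hence continuous. *)
definition test_functions :: "(real ^ 'n \<Rightarrow> complex) set" where
  "test_functions =
     {\<phi>. (\<forall>is x. iter_partial is \<phi> differentiable (at x)) \<and>
         (\<forall>i x. \<phi> (x + axis i (2 * pi)) = \<phi> x)}"

(* Periodic distributions are the continuous linear functionals on the smooth periodic functions.
   Only the values on test functions are meaningful.  Continuity is stated by the usual
   estimate against the seminorms that define the topology of the test functions. *)
type_synonym 'n functional = "(real ^ 'n \<Rightarrow> complex) \<Rightarrow> complex"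

definition periodic_distributions :: "'n::finite functional set" where
  "periodic_distributions =
     {T. (\<forall>\<phi>\<in>test_functions. \<forall>\<psi>\<in>test_functions. T (\<lambda>x. \<phi> x + \<psi> x) = T \<phi> + T \<psi>) \<and>
         (\<forall>c. \<forall>\<phi>\<in>test_functions. T (\<lambda>x. c * \<phi> x) = c * T \<phi>) \<and>
         (\<exists>C N. \<forall>\<phi>\<in>test_functions.
            norm (T \<phi>) \<le> C * (\<Sum>is | length is \<le> N. SUP x. norm (iter_partial is \<phi> x)))}"

definition fourier_coeff :: "'n::finite functional \<Rightarrow> int ^ 'n \<Rightarrow> complex" where
  "fourier_coeff T k = T (fourier_char (- k)) / (2 * pi) ^ CARD('n)"

definition sobolev :: "real \<Rightarrow> 'n::finite functional set" where
  "sobolev q =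
     {T \<in> periodic_distributions.
        (\<lambda>k. (1 + (norm (lattice_vec k))\<^sup>2) powr q * (norm (fourier_coeff T k))\<^sup>2)
          summable_on UNIV}"

(* The regular distribution induced by a function u on the torus. *)
definition regular_distr :: "(real ^ 'n \<Rightarrow> complex) \<Rightarrow> 'n::finite functional" where
  "regular_distr u \<phi> = integral torus (\<lambda>x. u x * \<phi> x)"

(* The series with general term a k * exp (i k.x), with convergence in the sense of
   distributions, i.e. after pairing with every test function. *)
definition fourier_series_converges :: "(int ^ 'n::finite \<Rightarrow> complex) \<Rightarrow> bool" where
  "fourier_series_converges a \<longleftrightarrow>
     (\<forall>\<phi>\<in>test_functions. (\<lambda>k. a k * regular_distr (fourier_char k) \<phi>) summable_on UNIV)"

definition fourier_series :: "(int ^ 'n::finite \<Rightarrow> complex) \<Rightarrow> 'n functional" where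
  "fourier_series a \<phi> = (\<Sum>\<^sub>\<infinity>k. a k * regular_distr (fourier_char k) \<phi>)"

definition wave_coeff ::
  "real \<Rightarrow> real \<Rightarrow> 'n::finite functional \<Rightarrow> 'n functional \<Rightarrow> real \<Rightarrow> int ^ 'n \<Rightarrow> complex" where
  "wave_coeff \<delta> \<beta> f g t k =
     (if k = 0 then fourier_coeff f 0 + fourier_coeff g 0 * of_real t
      else let \<omega> = sqrt (- multiplier \<delta> \<beta> (lattice_vec k))
           in fourier_coeff f k * of_real (cos (\<omega> * t)) +
              fourier_coeff g k / of_real \<omega> * of_real (sin (\<omega> * t)))"

definition wave ::
  "real \<Rightarrow> real \<Rightarrow> 'n::finite functional \<Rightarrow> 'n functional \<Rightarrow> real \<Rightarrow> 'n functional" where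
  "wave \<delta> \<beta> f g t = fourier_series (wave_coeff \<delta> \<beta> f g t)"

end

theory Submission
  imports Defs
begin

text \<open>
  Everything rests on the bound \<open>- m(\<nu>) \<ge> K (1 + |\<nu>|\<^sup>2)\<^sup>\<theta>\<close> for \<open>|\<nu>| \<ge> 1\<close>, which makes
  \<open>g\<^sub>k sin (\<omega> t) / \<omega>\<close> gain \<open>\<theta>\<close> derivatives over \<open>g\<^sub>k\<close>. Put \<open>c = n / 2\<close>, \<open>a = (n + 2 - \<beta>) / 2 > -1\<close>,
  \<open>x = |\<nu>|\<^sup>2 \<delta>\<^sup>2 / 4\<close>, and let \<open>F x\<close> be the hypergeometric factor, \<open>\<Phi> x\<close> the value of \<open>0F1(; c; - x)\<close>.
  The Bessel equation \<open>x \<Phi>'' + c \<Phi>' + \<Phi> = 0\<close> makes the energy \<open>\<Phi>\<^sup>2 + x \<Phi>'\<^sup>2\<close> nonincreasing, as \<open>c \<ge> 1 / 2\<close>;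
  hence \<open>|\<Phi>| \<le> 1\<close>. Comparing coefficients, \<open>x (x F' + a F) = a c (1 - \<Phi>)\<close>, so \<open>x\<^sup>a F\<close> is monotone for
  \<open>a > 0\<close> and \<open>x\<^sup>a (F - 1)\<close> is monotone for \<open>a < 0\<close>, which gives \<open>F \<ge> K x\<^bsup>-a\<^esup>\<close>. For \<open>a \<ge> 1\<close> the better
  bound \<open>F \<ge> K / x\<close> follows by integrating over \<open>[x / 2, x]\<close>, on which \<open>1 - \<Phi>\<close> has mean close to \<open>1\<close>.

  That the series is a distribution follows from the rapid decay of the Fourier coefficients of test
  functions, i.e. from \<open>\<integral> \<partial>\<^sub>i \<phi> = 0\<close> on the torus. This is obtained without Fubini, by differentiating the
  constant function \<open>h \<mapsto> \<integral> \<phi>(x + h e\<^sub>i) dx\<close>.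
\<close>

section \<open>The lower bound for the multiplier\<close>

definition hyp0F1_coeff :: "real \<Rightarrow> nat \<Rightarrow> real" where
  "hyp0F1_coeff c j = (- 1) ^ j / (fact j * pochhammer c j)"

text \<open>This is \<open>0F1(; c; - x)\<close>, for \<open>x > 0\<close> equal to
  \<open>Gamma c * x powr ((1 - c) / 2)\<close> times the Bessel function of order
  \<open>c - 1\<close> at \<open>2 * sqrt x\<close>.\<close>

definition hyp0F1 :: "real \<Rightarrow> real \<Rightarrow> real" where
  "hyp0F1 c x = (\<Sum>j. hyp0F1_coeff c j * x ^ j)"

text \<open>Only the first factor \<open>c\<close> of the product can be smaller than 1.\<close>

lemma pochhammer_ge_min:
  fixes c :: real
  assumes "c > 0"
  shows "min 1 c \<le> pochhammer c j"
proof (induction j)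
  case (Suc j)
  show ?case
  proof (cases j)
    case (Suc i)
    have "pochhammer c j > 0" using assms by (rule pochhammer_pos)
    moreover have "1 \<le> c + real j" using assms Suc by simp
    ultimately have "pochhammer c j * 1 \<le> pochhammer c j * (c + real j)"
      by (intro mult_left_mono) auto
    with Suc.IH show ?thesis by (simp add: pochhammer_Suc)
  qed simp
qed simp

text \<open>Domination by the exponential series gives convergence on the whole line, which termwise
  differentiation at every point requires.\<close>

lemma summable_power_series_fact_bound:
  fixes q :: "nat \<Rightarrow> real"
  assumes "\<And>j. \<bar>q j\<bar> \<le> K / fact j"
  shows "summable (\<lambda>j. q j * x ^ j)"
proof (rule summable_comparison_test')
  show "summable (\<lambda>j. K * (inverse (fact j) * \<bar>x\<bar> ^ j))"
    by (intro summable_mult summable_exp)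
  show "norm (q j * x ^ j) \<le> K * (inverse (fact j) * \<bar>x\<bar> ^ j)" if "j \<ge> 0" for j
    using mult_right_mono[OF assms[of j], of "\<bar>x\<bar> ^ j"]
    by (simp add: abs_mult power_abs field_simps)
qed

lemma summable_hyp0F1:
  assumes "c > 0"
  shows "summable (\<lambda>j. hyp0F1_coeff c j * x ^ j)"
proof (rule summable_power_series_fact_bound[where K = "1 / min 1 c"])
  fix j
  have "1 / pochhammer c j \<le> 1 / min 1 c"
    using pochhammer_ge_min[OF assms, of j] assms by (intro divide_left_mono) (auto simp: pochhammer_pos)
  then have "1 / pochhammer c j / fact j \<le> 1 / min 1 c / fact j"
    by (intro divide_right_mono) auto
  then show "\<bar>hyp0F1_coeff c j\<bar> \<le> 1 / min 1 c / fact j"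
    using pochhammer_pos[OF assms, of j]
    by (simp add: hyp0F1_coeff_def abs_mult power_abs mult.commute)
qed

lemma hyp0F1_sums:
  "c > 0 \<Longrightarrow> (\<lambda>j. hyp0F1_coeff c j * x ^ j) sums hyp0F1 c x"
  unfolding hyp0F1_def by (rule summable_sums[OF summable_hyp0F1])

lemma hyp0F1_0 [simp]: "hyp0F1 c 0 = 1"
  using powser_zero[of "hyp0F1_coeff c"] by (simp add: hyp0F1_def hyp0F1_coeff_def)

text \<open>Since \<open>pochhammer c (Suc j) = c * pochhammer (c + 1) j\<close>, differentiation
  shifts the parameter by one.\<close>

lemma diffs_hyp0F1_coeff:
  assumes "c > 0"
  shows "diffs (hyp0F1_coeff c) j = - (1 / c) * hyp0F1_coeff (c + 1) j"
proof -
  have "pochhammer (c + 1) j > 0" using assms by (intro pochhammer_pos) auto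
  then show ?thesis
    using assms by (simp add: diffs_def hyp0F1_coeff_def pochhammer_rec field_simps del: of_nat_Suc)
qed

lemma has_field_derivative_hyp0F1:
  assumes "c > 0"
  shows "(hyp0F1 c has_field_derivative - hyp0F1 (c + 1) x / c) (at x)"
proof -
  have "(hyp0F1 c has_field_derivative (\<Sum>j. diffs (hyp0F1_coeff c) j * x ^ j)) (at x)"
    unfolding hyp0F1_def[abs_def]
    by (rule termdiffs_strong_converges_everywhere[OF summable_hyp0F1[OF assms]])
  also have "(\<Sum>j. diffs (hyp0F1_coeff c) j * x ^ j)
      = (\<Sum>j. - (1 / c) * (hyp0F1_coeff (c + 1) j * x ^ j))"
    by (simp add: diffs_hyp0F1_coeff[OF assms] mult.assoc)
  also have "\<dots> = - (1 / c) * hyp0F1 (c + 1) x"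
    unfolding hyp0F1_def using assms by (intro suminf_mult summable_hyp0F1) auto
  finally show ?thesis by simp
qed

text \<open>The Bessel equation in derivative-free form:
  \<open>\<Phi>' = - hyp0F1 (c + 1) x / c\<close> and
  \<open>\<Phi>'' = hyp0F1 (c + 2) x / (c * (c + 1))\<close>.\<close>

lemma hyp0F1_contiguous:
  assumes "c > 0"
  shows "hyp0F1 (c + 1) x - hyp0F1 c x = x * hyp0F1 (c + 2) x / (c * (c + 1))"
proof -
  have eq: "hyp0F1_coeff (c + 1) (Suc j) - hyp0F1_coeff c (Suc j)
      = hyp0F1_coeff (c + 2) j / (c * (c + 1))" for j
  proof -
    have p: "pochhammer (c + 2) j > 0" "c + 1 > 0"
      using assms by (auto intro: pochhammer_pos)
    have e1: "pochhammer (c + 1) (Suc j) = (c + 1) * pochhammer (c + 2) j"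
      by (simp add: pochhammer_rec add.assoc)
    have e2: "pochhammer c (Suc j) * (c + 1 + real j) = c * ((c + 1) * pochhammer (c + 2) j)"
      using e1 pochhammer_Suc[of "c + 1" j] pochhammer_rec[of c j] by (simp add: algebra_simps)
    have e3: "pochhammer c (Suc j) = c * ((c + 1) * pochhammer (c + 2) j) / (c + 1 + real j)"
      using e2 p assms by (simp add: field_simps)
    \<comment> \<open>With factorial, sign and Pochhammer symbol replaced by variables, the
      coefficient identity is one between rational functions.\<close>
    have "- u / (w * J * (K * P)) - (- u) / (w * J * (c * (K * P) / (c + J))) = u / (w * P) / (c * K)"
      if "J > 0" "K > 0" "P > 0" "w > 0" for u w J K P :: real
      using that assms by (simp add: divide_simps) (simp add: algebra_simps)
    from this[of "1 + real j" "c + 1" "pochhammer (c + 2) j" "fact j" "(- 1) ^ j"] p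
    show ?thesis
      unfolding hyp0F1_coeff_def e1 e3 by (simp add: mult_ac add_ac)
  qed
  have "(\<lambda>j. hyp0F1_coeff (c + 1) j * x ^ j - hyp0F1_coeff c j * x ^ j)
      sums (hyp0F1 (c + 1) x - hyp0F1 c x)"
    using assms by (intro sums_diff hyp0F1_sums) auto
  \<comment> \<open>Both constant terms are 1 and cancel, so the sum may start at index 1.\<close>
  then have "(\<lambda>j. hyp0F1_coeff (c + 1) (Suc j) * x ^ Suc j - hyp0F1_coeff c (Suc j) * x ^ Suc j)
      sums (hyp0F1 (c + 1) x - hyp0F1 c x)"
    by (subst sums_Suc_iff) (simp add: hyp0F1_coeff_def)
  also have "(\<lambda>j. hyp0F1_coeff (c + 1) (Suc j) * x ^ Suc j - hyp0F1_coeff c (Suc j) * x ^ Suc j)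
      = (\<lambda>j. x / (c * (c + 1)) * (hyp0F1_coeff (c + 2) j * x ^ j))"
    by (subst left_diff_distrib[symmetric], subst eq) (simp add: field_simps)
  finally have "(\<lambda>j. x / (c * (c + 1)) * (hyp0F1_coeff (c + 2) j * x ^ j))
      sums (hyp0F1 (c + 1) x - hyp0F1 c x)" .
  moreover have "(\<lambda>j. x / (c * (c + 1)) * (hyp0F1_coeff (c + 2) j * x ^ j))
      sums (x / (c * (c + 1)) * hyp0F1 (c + 2) x)"
    using assms by (intro sums_mult hyp0F1_sums) auto
  ultimately show ?thesis
    using sums_unique2 by fastforce
qed

lemma hyp0F1_energy:
  assumes "c \<ge> 1 / 2" "x \<ge> 0"
  shows "(hyp0F1 c x)\<^sup>2 + x * (hyp0F1 (c + 1) x / c)\<^sup>2 \<le> 1"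
proof -
  have c: "c > 0" using assms by simp
  define E where "E = (\<lambda>x. (hyp0F1 c x)\<^sup>2 + x * (hyp0F1 (c + 1) x / c)\<^sup>2)"
  have "E x \<le> E 0"
  proof (rule DERIV_nonpos_imp_nonincreasing[OF \<open>x \<ge> 0\<close>])
    fix y :: real assume "0 \<le> y" "y \<le> x"
    \<comment> \<open>\<open>G\<close> is \<open>- \<Phi>'\<close>, hence \<open>D'\<close> below is
      \<open>- \<Phi>''\<close> at \<open>y\<close>. The Bessel equation then reads
      \<open>hyp0F1 c y - y * D' = c * D\<close>.\<close>
    define G where "G = (\<lambda>y. hyp0F1 (c + 1) y / c)"
    define D where "D = G y"
    define D' where "D' = - hyp0F1 (c + 2) y / (c * (c + 1))"
    have d1: "(hyp0F1 c has_field_derivative - D) (at y)"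
      using has_field_derivative_hyp0F1[OF c, of y] by (simp add: D_def G_def)
    have d2: "(G has_field_derivative D') (at y)"
      using DERIV_cdivide[OF has_field_derivative_hyp0F1[of "c + 1" y], of c] c
      by (simp add: G_def D'_def add.assoc mult.commute)
    have E: "E = (\<lambda>x. (hyp0F1 c x)\<^sup>2 + x * (G x)\<^sup>2)"
      by (simp add: E_def G_def)
    have "(E has_field_derivative - 2 * D * (hyp0F1 c y - y * D') + D\<^sup>2) (at y)"
      unfolding E by (auto intro!: derivative_eq_intros d1 d2 simp: D_def algebra_simps power2_eq_square)
    also have "hyp0F1 c y - y * D' = c * D"
      using hyp0F1_contiguous[OF c, of y] c by (simp add: D_def D'_def G_def)
    also have "- 2 * D * (c * D) + D\<^sup>2 = (1 - 2 * c) * D\<^sup>2"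
      by (simp add: power2_eq_square algebra_simps)
    finally have "(E has_field_derivative (1 - 2 * c) * D\<^sup>2) (at y)" .
    moreover have "(1 - 2 * c) * D\<^sup>2 \<le> 0"
      using assms by (intro mult_nonpos_nonneg) auto
    ultimately show "\<exists>d. (E has_real_derivative d) (at y) \<and> d \<le> 0" by blast
  qed
  then show ?thesis by (simp add: E_def)
qed

lemma abs_hyp0F1_le_1:
  assumes "c \<ge> 1 / 2" "x \<ge> 0"
  shows "\<bar>hyp0F1 c x\<bar> \<le> 1"
proof -
  have "0 \<le> x * (hyp0F1 (c + 1) x / c)\<^sup>2" using assms by simp
  then have "(hyp0F1 c x)\<^sup>2 \<le> 1" using hyp0F1_energy[OF assms] by linarith
  then show ?thesis by (simp add: abs_square_le_1)
qed

text \<open>The derivative part of the energy is at most 1 by itself. Consequently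
  \<open>x \<Phi>'\<close> is of lower order than \<open>x\<close>, which controls the oscillating
  term of \<open>\<Psi>\<close>.\<close>

lemma abs_deriv_hyp0F1_le:
  assumes "c \<ge> 1 / 2" "x \<ge> 0"
  shows "\<bar>x * (hyp0F1 (c + 1) x / c)\<bar> \<le> sqrt x"
proof -
  have "x * (hyp0F1 (c + 1) x / c)\<^sup>2 \<le> 1"
    using hyp0F1_energy[OF assms] zero_le_power2[of "hyp0F1 c x"] by linarith
  then have "x * (x * (hyp0F1 (c + 1) x / c)\<^sup>2) \<le> x * 1"
    using assms by (intro mult_left_mono) auto
  then have "(x * (hyp0F1 (c + 1) x / c))\<^sup>2 \<le> x"
    by (simp add: power2_eq_square algebra_simps)
  then show ?thesis by (metis real_sqrt_abs real_sqrt_le_iff)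
qed

text \<open>The bound on \<open>hyp0F1 (c + 1)\<close> gives \<open>\<Phi>' \<ge> - 1 / c\<close>,
  and \<open>\<Phi> 0 = 1\<close>. For \<open>a < 0\<close> this fixes the sign of the derivative of
  \<open>x powr a * (F x - 1)\<close>.\<close>

lemma one_minus_hyp0F1_le:
  assumes "c \<ge> 1 / 2" "x \<ge> 0"
  shows "1 - hyp0F1 c x \<le> x / c"
proof -
  have c: "c > 0" using assms by simp
  have "1 - hyp0F1 c x - x / c \<le> 1 - hyp0F1 c 0 - 0 / c"
  proof (rule DERIV_nonpos_imp_nonincreasing[OF \<open>x \<ge> 0\<close>])
    fix y :: real assume y: "0 \<le> y" "y \<le> x"
    have "((\<lambda>y. 1 - hyp0F1 c y - y / c) has_real_derivative (hyp0F1 (c + 1) y - 1) / c) (at y)"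
      using c by (auto intro!: derivative_eq_intros has_field_derivative_hyp0F1
          simp: field_simps)
    moreover have "(hyp0F1 (c + 1) y - 1) / c \<le> 0"
      using abs_hyp0F1_le_1[of "c + 1" y] assms y c by (intro divide_nonpos_pos) auto
    ultimately show "\<exists>d. ((\<lambda>y. 1 - hyp0F1 c y - y / c) has_real_derivative d) (at y) \<and> d \<le> 0"
      by blast
  qed
  then show ?thesis by simp
qed

section \<open>The hypergeometric factor as a power series\<close>

definition hyp2F3_coeff :: "real \<Rightarrow> real \<Rightarrow> nat \<Rightarrow> real" where
  "hyp2F3_coeff a c j = (pochhammer 1 j * pochhammer a j) /
     (pochhammer 2 j * pochhammer (c + 1) j * pochhammer (a + 1) j) * ((- 1) ^ j / fact j)"

lemma hyp2F3_eq_power_series: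
  "hyp2F3 1 a 2 (c + 1) (a + 1) (- x) = (\<Sum>j. hyp2F3_coeff a c j * x ^ j)"
proof -
  have "(- x) ^ j = (- 1) ^ j * x ^ j" for j :: nat
    by (metis mult_minus1 power_mult_distrib)
  then show ?thesis by (simp add: hyp2F3_def hyp2F3_coeff_def mult.assoc)
qed

text \<open>Both sides are \<open>pochhammer a (Suc j)\<close>. The upper parameter \<open>a\<close>
  and the lower parameter \<open>a + 1\<close> thus contribute just
  \<open>a / (a + real j)\<close>.\<close>

lemma pochhammer_shift: "(a + real j) * pochhammer a j = a * pochhammer (a + 1) j"
  by (metis mult.commute pochhammer_Suc pochhammer_rec)

lemma pochhammer_1_2: "pochhammer 2 j = real (Suc j) * pochhammer 1 j"
  using pochhammer_shift[of 1 j] by simp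

text \<open>For \<open>j \<ge> 1\<close> the quotient \<open>a / (a + real j)\<close> is at most
  \<open>\<bar>a\<bar> / (a + 1)\<close> in modulus, because \<open>a + 1 > 0\<close>; the summand 1
  covers \<open>j = 0\<close>, where the Pochhammer quotient is 1 even if
  \<open>a = 0\<close>.\<close>

lemma abs_hyp2F3_coeff_le:
  assumes a: "a > - 1" and c: "c > 0"
  shows "\<bar>hyp2F3_coeff a c j\<bar> \<le> (1 + \<bar>a\<bar> / (a + 1)) / fact j"
proof -
  have p: "pochhammer (a + 1) j > 0" "pochhammer (c + 1) j \<ge> 1" "pochhammer 1 j > (0::real)"
    using a c pochhammer_ge_min[of "c + 1" j] by (auto intro: pochhammer_pos)
  have r: "\<bar>pochhammer a j / pochhammer (a + 1) j\<bar> \<le> 1 + \<bar>a\<bar> / (a + 1)"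
  proof (cases j)
    case (Suc i)
    then have pos: "a + real j > 0" using a by simp
    have "pochhammer a j / pochhammer (a + 1) j = a / (a + real j)"
      using pochhammer_shift[of a j] p pos by (simp add: field_simps)
    moreover have "\<bar>a\<bar> / (a + real j) \<le> \<bar>a\<bar> / (a + 1)"
      using a Suc by (intro divide_left_mono) auto
    ultimately show ?thesis using pos by simp
  qed (use a in auto)
  have d: "real (Suc j) * pochhammer (c + 1) j \<ge> 1"
    using p(2) mult_mono[of 1 "real (Suc j)" 1 "pochhammer (c + 1) j"] by simp
  have "hyp2F3_coeff a c j
      = (pochhammer a j / pochhammer (a + 1) j) * (1 / (real (Suc j) * pochhammer (c + 1) j))
        * ((- 1) ^ j / fact j)"
    unfolding hyp2F3_coeff_def pochhammer_1_2 using p by (simp add: field_simps del: of_nat_Suc)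
  then have "\<bar>hyp2F3_coeff a c j\<bar>
      = \<bar>pochhammer a j / pochhammer (a + 1) j\<bar> * (1 / (real (Suc j) * pochhammer (c + 1) j)) / fact j"
    using d p(2) by (simp add: abs_mult power_abs del: of_nat_Suc)
  also have "\<dots> \<le> (1 + \<bar>a\<bar> / (a + 1)) * 1 / fact j"
    using r d a by (intro divide_right_mono mult_mono) (auto simp del: of_nat_Suc)
  finally show ?thesis by simp
qed

text \<open>In the application \<open>a > - 1\<close> expresses \<open>\<beta> < n + 4\<close>, and
  \<open>c \<ge> 1 / 2\<close> expresses \<open>n \<ge> 1\<close>.\<close>

locale multiplier_series =
  fixes a c :: real
  assumes a: "a > - 1" and c: "c \<ge> 1 / 2"
begin

definition F :: "real \<Rightarrow> real" where
  "F x = (\<Sum>j. hyp2F3_coeff a c j * x ^ j)"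

definition dF :: "real \<Rightarrow> real" where
  "dF x = (\<Sum>j. diffs (hyp2F3_coeff a c) j * x ^ j)"

lemma c_pos: "c > 0" using c by simp

lemma summable_F: "summable (\<lambda>j. hyp2F3_coeff a c j * x ^ j)"
  by (rule summable_power_series_fact_bound[OF abs_hyp2F3_coeff_le[OF a c_pos]])

lemma DERIV_F: "(F has_field_derivative dF x) (at x)"
  unfolding F_def[abs_def] dF_def
  by (rule termdiffs_strong_converges_everywhere[OF summable_F])

lemma F_0: "F 0 = 1"
  using powser_zero[of "hyp2F3_coeff a c"] by (simp add: F_def hyp2F3_coeff_def)

lemma dF_0: "dF 0 = - a / (2 * (c + 1) * (a + 1))"
  using powser_zero[of "diffs (hyp2F3_coeff a c)"]
  by (simp add: dF_def diffs_def hyp2F3_coeff_def)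

text \<open>The operator \<open>x d/dx + a\<close> multiplies coefficient \<open>j\<close> by
  \<open>a + real j\<close> and so cancels the parameters \<open>a\<close> and \<open>a + 1\<close>.
  What is left is the \<open>0F1\<close> series with its index shifted by one, which the outer
  factor \<open>x\<close> compensates.\<close>

lemma F_ode: "x * (x * dF x + a * F x) = a * c * (1 - hyp0F1 c x)"
proof -
  let ?q = "hyp2F3_coeff a c"
  have "(\<lambda>j. diffs ?q j * x ^ j) sums dF x"
    unfolding dF_def by (intro summable_sums termdiff_converges_all summable_F)
  then have "(\<lambda>j. x * (diffs ?q j * x ^ j)) sums (x * dF x)" by (rule sums_mult)
  then have "(\<lambda>j. real (Suc j) * ?q (Suc j) * x ^ Suc j) sums (x * dF x)"
    by (simp add: diffs_def algebra_simps del: of_nat_Suc)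
  \<comment> \<open>The factor \<open>real j\<close> kills the term at 0, so shifting the index back
    costs nothing.\<close>
  then have "(\<lambda>j. real j * ?q j * x ^ j) sums (x * dF x)"
    by (subst (asm) sums_Suc_iff) simp
  moreover have "(\<lambda>j. ?q j * x ^ j) sums F x"
    unfolding F_def by (rule summable_sums[OF summable_F])
  ultimately have "(\<lambda>j. x * (real j * ?q j * x ^ j + a * (?q j * x ^ j)))
      sums (x * (x * dF x + a * F x))"
    by (intro sums_mult sums_add)
  moreover have "x * (real j * ?q j * x ^ j + a * (?q j * x ^ j))
      = - (a * c) * (hyp0F1_coeff c (Suc j) * x ^ Suc j)" for j
  proof -
    have p: "pochhammer (a + 1) j > 0" "pochhammer (c + 1) j > 0" "pochhammer 1 j > (0::real)"
      using a c by (auto intro: pochhammer_pos)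
    have "(a + real j) * ?q j = (a + real j) * pochhammer a j * (pochhammer 1 j /
       (pochhammer 2 j * pochhammer (c + 1) j * pochhammer (a + 1) j) * ((- 1) ^ j / fact j))"
      by (simp add: hyp2F3_coeff_def)
    also have "\<dots> = - (a * c) * hyp0F1_coeff c (Suc j)"
      unfolding pochhammer_shift pochhammer_1_2 hyp0F1_coeff_def pochhammer_rec[of c]
      using p c by (simp add: field_simps del: of_nat_Suc)
    finally have "(a + real j) * ?q j * x ^ Suc j = - (a * c) * hyp0F1_coeff c (Suc j) * x ^ Suc j"
      by simp
    then show ?thesis by (simp add: algebra_simps)
  qed
  ultimately have *: "(\<lambda>j. - (a * c) * (hyp0F1_coeff c (Suc j) * x ^ Suc j))
      sums (x * (x * dF x + a * F x))" by simp
  have "(\<lambda>j. hyp0F1_coeff c j * x ^ j) sums ((hyp0F1 c x - 1) + hyp0F1_coeff c 0 * x ^ 0)"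
    using hyp0F1_sums[OF c_pos, of x] by (simp add: hyp0F1_coeff_def)
  then have "(\<lambda>j. hyp0F1_coeff c (Suc j) * x ^ Suc j) sums (hyp0F1 c x - 1)"
    by (subst sums_Suc_iff) simp
  then have "(\<lambda>j. - (a * c) * (hyp0F1_coeff c (Suc j) * x ^ Suc j))
      sums (- (a * c) * (hyp0F1 c x - 1))" by (rule sums_mult)
  from sums_unique2[OF * this] show ?thesis by (simp add: algebra_simps)
qed

text \<open>\<open>x powr a\<close> is the integrating factor of \<open>F_ode\<close>. The shift
  \<open>d\<close> is 0 for \<open>a > 0\<close> and 1 for \<open>a < 0\<close>.\<close>

lemma DERIV_powr_F:
  assumes "x > 0"
  shows "((\<lambda>x. x powr a * (F x - d)) has_field_derivative
    a * x powr (a - 2) * (c * (1 - hyp0F1 c x) - d * x)) (at x)"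
proof -
  have p: "x powr a = x\<^sup>2 * x powr (a - 2)" "x powr (a - 1) = x * x powr (a - 2)"
    using assms powr_add[of x 2 "a - 2"] powr_add[of x 1 "a - 2"] by (auto simp: )
  have "((\<lambda>x. x powr a * (F x - d)) has_field_derivative
      x powr a * dF x + a * x powr (a - 1) * (F x - d)) (at x)"
    using assms by (auto intro!: derivative_eq_intros DERIV_F)
  also have "x powr a * dF x + a * x powr (a - 1) * (F x - d)
      = x powr (a - 2) * (x * (x * dF x + a * F x) - a * d * x)"
    unfolding p by (simp add: power2_eq_square algebra_simps)
  finally show ?thesis
    unfolding F_ode by (simp add: algebra_simps)
qed


section \<open>Lower bounds for \<open>F\<close>, by the sign and size of \<open>a\<close>\<close>

lemma F_pos_near_0:
  assumes "X > 0"
  obtains e where "0 < e" "e < X" "F e > 0"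
proof -
  have "isCont F 0" using DERIV_F by (rule DERIV_isCont)
  then have "(F \<longlongrightarrow> 1) (at_right 0)"
    using F_0 by (metis isCont_def filterlim_at_split)
  then have "\<forall>\<^sub>F x in at_right 0. F x > 0" by (rule order_tendstoD) simp
  moreover have "\<forall>\<^sub>F x in at_right 0. x \<in> {0<..<X}"
    using assms by (rule eventually_at_right_real)
  ultimately have "\<forall>\<^sub>F x in at_right 0. F x > 0 \<and> x \<in> {0<..<X}"
    by (rule eventually_conj)
  then obtain e where "F e > 0 \<and> e \<in> {0<..<X}"
    using eventually_happens'[OF trivial_limit_at_right_real] by blast
  then show ?thesis using that by auto
qed

lemma powr_F_mono:
  assumes "a > 0" "0 < x" "x \<le> y"
  shows "x powr a * F x \<le> y powr a * F y"
proof -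
  have "x powr a * (F x - 0) \<le> y powr a * (F y - 0)"
  proof (rule DERIV_nonneg_imp_nondecreasing[OF \<open>x \<le> y\<close>])
    fix z assume "x \<le> z" "z \<le> y"
    then have z: "z > 0" using assms by simp
    have "a * z powr (a - 2) * (c * (1 - hyp0F1 c z) - 0 * z) \<ge> 0"
      using abs_hyp0F1_le_1[OF c, of z] z assms c by simp
    with DERIV_powr_F[OF z, of 0]
    show "\<exists>d. ((\<lambda>x. x powr a * (F x - 0)) has_real_derivative d) (at z) \<and> 0 \<le> d" by blast
  qed
  then show ?thesis by simp
qed

text \<open>Monotonicity needs a positive starting value; \<open>F 0 = 1\<close> and continuity
  provide one at some \<open>e < X\<close>.\<close>

lemma powr_F_lower_bound:
  assumes "a > 0" "X > 0"
  obtains K where "K > 0" "\<And>x. x \<ge> X \<Longrightarrow> x powr a * F x \<ge> K"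
proof -
  obtain e where e: "0 < e" "e < X" "F e > 0" using F_pos_near_0[OF assms(2)] .
  show ?thesis
    by (rule that[of "e powr a * F e"]) (use e assms powr_F_mono[of e] in auto)
qed

lemma x_F_eq: "x > 0 \<Longrightarrow> x * F x = x powr (1 - a) * (x powr a * F x)"
  using powr_add[of x "1 - a" a] by simp

text \<open>For \<open>a < 0\<close> the derivative of \<open>F\<close> at 0 is positive, so
  \<open>F e > 1\<close> for some small \<open>e\<close>; the monotone quantity
  \<open>x powr a * (F x - 1)\<close> stays above its positive value there.\<close>

lemma x_F_lower_bound_neg:
  assumes "a < 0" "X > 0"
  obtains K where "K > 0" "\<And>x. x \<ge> X \<Longrightarrow> x * F x \<ge> K * x powr (1 - a)"
proof -
  have "dF 0 > 0" using assms(1) a c_pos by (simp add: dF_0 divide_neg_pos)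
  from DERIV_pos_inc_right[OF DERIV_F this] obtain d
    where d: "d > 0" "\<And>h. h > 0 \<Longrightarrow> h < d \<Longrightarrow> F 0 < F (0 + h)" by blast
  define e where "e = min d X / 2"
  have e: "e > 0" "e < d" "e < X" using d assms by (auto simp: e_def)
  have Fe: "F e > 1" using d(2)[of e] e F_0 by simp
  define K where "K = e powr a * (F e - 1)"
  show ?thesis
  proof (rule that)
    show "K > 0" using e Fe by (simp add: K_def)
    fix x assume "x \<ge> X"
    then have x: "x > 0" "e \<le> x" using e assms by auto
    \<comment> \<open>\<open>x powr a * F x\<close> itself is decreasing; without the constant term \<open>F 0 = 1\<close> it increases.\<close>
    have "K \<le> x powr a * (F x - 1)"
      unfolding K_def
    proof (rule DERIV_nonneg_imp_nondecreasing[OF \<open>e \<le> x\<close>])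
      fix z assume "e \<le> z" "z \<le> x"
      then have z: "z > 0" using e by simp
      have "c * (1 - hyp0F1 c z) - 1 * z \<le> 0"
        using one_minus_hyp0F1_le[OF c, of z] z c_pos by (simp add: field_simps)
      then have "a * z powr (a - 2) * (c * (1 - hyp0F1 c z) - 1 * z) \<ge> 0"
        using assms by (intro mult_nonpos_nonpos) (auto intro: mult_nonpos_nonneg)
      with DERIV_powr_F[OF z, of 1]
      show "\<exists>d. ((\<lambda>x. x powr a * (F x - 1)) has_real_derivative d) (at z) \<and> 0 \<le> d" by blast
    qed
    also have "\<dots> \<le> x powr a * F x" using x by simp
    finally show "x * F x \<ge> K * x powr (1 - a)"
      unfolding x_F_eq[OF x(1)] by (subst mult.commute) (intro mult_left_mono, auto)
  qed
qed

text \<open>A primitive of \<open>1 - hyp0F1 c\<close>, available in closed form because of the Bessel equation.\<close>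

definition \<Psi> :: "real \<Rightarrow> real" where
  "\<Psi> x = x - x * (hyp0F1 (c + 1) x / c) + (c - 1) * (hyp0F1 c x - 1)"

text \<open>By the Bessel equation \<open>(x \<Phi>')' = (1 - c) \<Phi>' - \<Phi>\<close>, so
  \<open>- x \<Phi>' - (c - 1) \<Phi>\<close> is a primitive of \<open>\<Phi>\<close>.\<close>

lemma DERIV_\<Psi>: "(\<Psi> has_field_derivative 1 - hyp0F1 c x) (at x)"
proof -
  define G where "G = (\<lambda>x. hyp0F1 (c + 1) x / c)"
  define D where "D = - hyp0F1 (c + 2) x / (c * (c + 1))"
  have d1: "(hyp0F1 c has_field_derivative - G x) (at x)"
    using has_field_derivative_hyp0F1[OF c_pos, of x] by (simp add: G_def)
  have d2: "(G has_field_derivative D) (at x)"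
    using DERIV_cdivide[OF has_field_derivative_hyp0F1[of "c + 1" x], of c] c_pos
    by (simp add: G_def D_def add.assoc mult.commute)
  have "\<Psi> = (\<lambda>x. x - x * G x + (c - 1) * (hyp0F1 c x - 1))"
    by (simp add: \<Psi>_def[abs_def] G_def)
  then have "(\<Psi> has_field_derivative 1 - (G x + x * D) + (c - 1) * (- G x)) (at x)"
    by (auto intro!: derivative_eq_intros d1 d2)
  moreover have "x * D = hyp0F1 c x - c * G x"
    using hyp0F1_contiguous[OF c_pos, of x] c_pos by (simp add: D_def G_def)
  ultimately show ?thesis by (simp add: algebra_simps)
qed

text \<open>The main term is \<open>x / 2\<close>, the error at most
  \<open>2 * sqrt x + 2 * c + 2\<close>. From \<open>300 \<ge> 16 * 16\<close> follows
  \<open>sqrt x \<le> x / 16\<close>, and the threshold also gives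
  \<open>2 * c + 2 \<le> x / 8\<close>; together the error is at most \<open>x / 4\<close>.\<close>

lemma \<Psi>_half_diff:
  assumes "x \<ge> 300 + 16 * c"
  shows "\<Psi> x - \<Psi> (x / 2) \<ge> x / 4"
proof -
  have x: "x \<ge> 0" using assms c_pos by linarith
  have "\<bar>(c - 1) * (hyp0F1 c x - hyp0F1 c (x / 2))\<bar> \<le> (c + 1) * 2"
    unfolding abs_mult using abs_hyp0F1_le_1[OF c, of x] abs_hyp0F1_le_1[OF c, of "x / 2"] x
      c_pos
    by (intro mult_mono) auto
  also have "(c + 1) * 2 = 2 * c + 2" by simp
  finally have "\<bar>(c - 1) * (hyp0F1 c x - hyp0F1 c (x / 2))\<bar> \<le> 2 * c + 2" .
  moreover have "\<Psi> x - \<Psi> (x / 2) = x / 2 - x * (hyp0F1 (c + 1) x / c)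
      + x / 2 * (hyp0F1 (c + 1) (x / 2) / c) + (c - 1) * (hyp0F1 c x - hyp0F1 c (x / 2))"
    by (simp add: \<Psi>_def algebra_simps)
  ultimately have "\<Psi> x - \<Psi> (x / 2) \<ge> x / 2 - sqrt x - sqrt (x / 2) - 2 * c - 2"
    using abs_deriv_hyp0F1_le[OF c, of x] abs_deriv_hyp0F1_le[OF c, of "x / 2"] x by linarith
  moreover have "sqrt (x / 2) \<le> sqrt x" using x by simp
  moreover have "16 * sqrt x \<le> x"
  proof -
    have "16 \<le> sqrt x" using assms c_pos by (intro real_le_rsqrt) simp
    then have "16 * sqrt x \<le> sqrt x * sqrt x" using x by (intro mult_right_mono) auto
    then show ?thesis using x by simp
  qed
  ultimately show ?thesis using assms by linarith
qed

text \<open>On \<open>[x / 2, x]\<close> the function \<open>y powr a * F y\<close> grows at least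
  as fast as \<open>a * c * \<mu> * \<Psi> y\<close>, and the growth of \<open>\<Psi>\<close> there
  is known.\<close>

lemma powr_F_lower_bound_large:
  assumes "a > 0" "x \<ge> 300 + 16 * c"
  shows "x powr a * F x \<ge> a * c * min 1 (2 powr (2 - a)) / 4 * x powr (a - 1)"
proof -
  have x: "x > 0" using assms c_pos by linarith
  \<comment> \<open>The minimum of \<open>y powr (a - 2)\<close> over \<open>[x / 2, x]\<close>,
    attained at the left end for \<open>a \<ge> 2\<close> and at the right end otherwise.\<close>
  define \<mu> where "\<mu> = min 1 (2 powr (2 - a)) * x powr (a - 2)"
  have \<mu>: "\<mu> \<ge> 0" by (simp add: \<mu>_def)
  have le: "\<mu> \<le> y powr (a - 2)" if "x / 2 \<le> y" "y \<le> x" for y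
  proof (cases "a \<ge> 2")
    case True
    have "\<mu> \<le> 2 powr (2 - a) * x powr (a - 2)"
      unfolding \<mu>_def by (intro mult_right_mono) auto
    also have "\<dots> = (x / 2) powr (a - 2)"
      using x powr_minus[of 2 "a - 2"] by (simp add: powr_divide field_simps)
    also have "\<dots> \<le> y powr (a - 2)" using True x that by (intro powr_mono2) auto
    finally show ?thesis .
  next
    case False
    have "\<mu> \<le> 1 * x powr (a - 2)"
      unfolding \<mu>_def by (intro mult_right_mono) auto
    also have "1 * x powr (a - 2) \<le> y powr (a - 2)" using False x that by (auto intro: powr_mono2')
    finally show ?thesis .
  qed
  have "(x / 2) powr a * (F (x / 2) - 0) - a * c * \<mu> * \<Psi> (x / 2)
      \<le> x powr a * (F x - 0) - a * c * \<mu> * \<Psi> x"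
  proof (rule DERIV_nonneg_imp_nondecreasing[where f = "\<lambda>x. x powr a * (F x - 0) - a * c * \<mu> * \<Psi> x"])
    show "x / 2 \<le> x" using x by simp
    fix y assume y: "x / 2 \<le> y" "y \<le> x"
    then have y0: "y > 0" using x by simp
    have "a * y powr (a - 2) * (c * (1 - hyp0F1 c y) - 0 * y) - a * c * \<mu> * (1 - hyp0F1 c y)
        = a * c * (y powr (a - 2) - \<mu>) * (1 - hyp0F1 c y)" by (simp add: algebra_simps)
    also have "\<dots> \<ge> 0"
      using le[OF y] abs_hyp0F1_le_1[OF c, of y] y0 assms c_pos by simp
    finally have "0 \<le> a * y powr (a - 2) * (c * (1 - hyp0F1 c y) - 0 * y)
        - a * c * \<mu> * (1 - hyp0F1 c y)" .
    then show "\<exists>d. ((\<lambda>x. x powr a * (F x - 0) - a * c * \<mu> * \<Psi> x) has_real_derivative d) (at y) \<and> 0 \<le> d"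
      using DERIV_diff[OF DERIV_powr_F[OF y0, of 0] DERIV_cmult[OF DERIV_\<Psi>]] by blast
  qed
  moreover have "(x / 2) powr a * F (x / 2) \<ge> 0"
  proof -
    obtain K where "K > 0" "\<And>y. y \<ge> x / 2 \<Longrightarrow> y powr a * F y \<ge> K"
      using powr_F_lower_bound[of "x / 2"] assms x by auto
    then show ?thesis using order_less_imp_le order_trans by blast
  qed
  ultimately have "x powr a * F x \<ge> a * c * \<mu> * (\<Psi> x - \<Psi> (x / 2))"
    by (simp add: algebra_simps)
  moreover have "a * c * \<mu> * (\<Psi> x - \<Psi> (x / 2)) \<ge> a * c * \<mu> * (x / 4)"
    using \<Psi>_half_diff[OF assms(2)] \<mu> assms c_pos by (intro mult_left_mono) auto
  moreover have "a * c * \<mu> * (x / 4) = a * c * min 1 (2 powr (2 - a)) / 4 * x powr (a - 1)"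
    using x powr_add[of x "a - 2" 1] by (simp add: \<mu>_def)
  ultimately show ?thesis by linarith
qed

text \<open>Beyond the threshold \<open>Y\<close> the averaged bound applies. Between
  \<open>X\<close> and \<open>Y\<close> the monotone bound suffices, as
  \<open>x powr (1 - a)\<close> is nonincreasing and hence at least
  \<open>Y powr (1 - a)\<close>.\<close>

lemma x_F_lower_bound_ge_1:
  assumes "a \<ge> 1" "X > 0"
  obtains K where "K > 0" "\<And>x. x \<ge> X \<Longrightarrow> x * F x \<ge> K"
proof -
  define Y where "Y = 300 + 16 * c"
  define K2 where "K2 = a * c * min 1 (2 powr (2 - a)) / 4"
  obtain K1 where K1: "K1 > 0" "\<And>x. x \<ge> X \<Longrightarrow> x powr a * F x \<ge> K1"
    using powr_F_lower_bound[of X] assms by auto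
  have Y: "Y > 0" unfolding Y_def using c_pos by linarith
  have K2: "K2 > 0" using assms c_pos by (simp add: K2_def)
  show ?thesis
  proof (rule that)
    show "min K2 (Y powr (1 - a) * K1) > 0" using K1 K2 Y by simp
    fix x assume "x \<ge> X"
    then have x: "x > 0" using assms by simp
    show "min K2 (Y powr (1 - a) * K1) \<le> x * F x"
    proof (cases "x \<ge> Y")
      case True
      have "K2 = x powr (1 - a) * (K2 * x powr (a - 1))"
        using x powr_add[of x "1 - a" "a - 1"] by simp
      also have "\<dots> \<le> x powr (1 - a) * (x powr a * F x)"
        using powr_F_lower_bound_large[of x] True assms
        unfolding K2_def Y_def by (intro mult_left_mono) auto
      finally show ?thesis unfolding x_F_eq[OF x] by simp
    next
      case False
      have "Y powr (1 - a) * K1 \<le> x powr (1 - a) * (x powr a * F x)"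
        using False x assms K1 \<open>x \<ge> X\<close> by (intro mult_mono powr_mono2') auto
      then show ?thesis unfolding x_F_eq[OF x] by simp
    qed
  qed
qed

lemma F_eq_1:
  assumes "a = 0"
  shows "F x = 1"
proof -
  have "F x = (\<Sum>j\<in>{0}. hyp2F3_coeff a c j * x ^ j)"
    unfolding F_def using assms
    by (intro suminf_finite) (auto simp: hyp2F3_coeff_def pochhammer_0_left)
  then show ?thesis by (simp add: hyp2F3_coeff_def)
qed

lemma x_F_lower_bound:
  assumes "X > 0"
  obtains K where "K > 0" "\<And>x. x \<ge> X \<Longrightarrow> x * F x \<ge> K * x powr (max 0 (1 - a))"
proof -
  consider "a < 0" | "a = 0" | "0 < a" "a < 1" | "a \<ge> 1" by linarith
  then show ?thesis
  proof cases
    case 1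
    then show ?thesis using x_F_lower_bound_neg[OF _ assms] that by (simp add: max_def) blast
  next
    case 2
    show ?thesis by (rule that[of 1]) (use 2 F_eq_1 assms in auto)
  next
    case 3
    obtain K where K: "K > 0" "\<And>x. x \<ge> X \<Longrightarrow> x powr a * F x \<ge> K"
      using powr_F_lower_bound[OF 3(1) assms] by auto
    show ?thesis
    proof (rule that[OF K(1)])
      fix x assume "x \<ge> X"
      then show "K * x powr max 0 (1 - a) \<le> x * F x"
        using 3 assms mult_left_mono[OF K(2)[of x], of "x powr (1 - a)"]
        by (subst x_F_eq) (auto simp: mult.commute)
    qed
  next
    case 4
    obtain K where K: "K > 0" "\<And>x. x \<ge> X \<Longrightarrow> x * F x \<ge> K"
      using x_F_lower_bound_ge_1[OF 4 assms] by auto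
    show ?thesis by (rule that[OF K(1)]) (use K 4 assms in auto)
  qed
qed

end

text \<open>With \<open>r\<close> the squared norm,
  \<open>- multiplier \<delta> \<beta> \<nu>\<close> is \<open>r * F (r * X)\<close>, and
  \<open>1 - a = (\<beta> - n) / 2\<close>. The condition \<open>r \<ge> 1\<close> places the
  argument beyond \<open>X\<close> and makes \<open>r\<close> comparable with
  \<open>1 + r\<close>.\<close>

lemma multiplier_lower_bound:
  fixes \<delta> \<beta> :: real
  assumes \<delta>: "\<delta> > 0" and \<beta>: "\<beta> < real CARD('n) + 4"
  obtains K where "K > 0"
    "\<And>\<nu> :: real ^ 'n::finite. norm \<nu> \<ge> 1 \<Longrightarrow>
       - multiplier \<delta> \<beta> \<nu> \<ge> K * (1 + (norm \<nu>)\<^sup>2) powr (max 0 ((\<beta> - real CARD('n)) / 2))"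
proof -
  define a where "a = (real CARD('n) + 2 - \<beta>) / 2"
  define c where "c = real CARD('n) / 2"
  have "CARD('n) \<ge> 1" by (simp add: Suc_leI)
  then interpret multiplier_series a c
    using \<beta> by unfold_locales (auto simp: a_def c_def field_simps)
  define \<theta> where "\<theta> = max 0 ((\<beta> - real CARD('n)) / 2)"
  define X where "X = \<delta>\<^sup>2 / 4"
  have X: "X > 0" using \<delta> by (simp add: X_def)
  have \<theta>: "max 0 (1 - a) = \<theta>" "\<theta> \<ge> 0" by (auto simp: \<theta>_def a_def field_simps)
  obtain K where K: "K > 0" "\<And>x. x \<ge> X \<Longrightarrow> x * F x \<ge> K * x powr \<theta>"
    using x_F_lower_bound[OF X] unfolding \<theta> by blast
  \<comment> \<open>\<open>X / 2\<close> comes from \<open>r * X \<ge> (X / 2) * (1 + r)\<close>;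
    the division by \<open>X\<close> passes from \<open>x * F x\<close> to
    \<open>r * F (r * X)\<close>.\<close>
  define L where "L = K * (X / 2) powr \<theta> / X"
  show ?thesis
  proof (rule that)
    show "L > 0" using K X by (simp add: L_def)
    fix \<nu> :: "real ^ 'n" assume "norm \<nu> \<ge> 1"
    define r where "r = (norm \<nu>)\<^sup>2"
    have r: "r \<ge> 1" using \<open>norm \<nu> \<ge> 1\<close> by (simp add: r_def)
    have bc: "(real CARD('n) + 2) / 2 = c + 1" "(real CARD('n) + 4 - \<beta>) / 2 = a + 1"
      "(real CARD('n) + 2 - \<beta>) / 2 = a" "- (1 / 4) * (norm \<nu>)\<^sup>2 * \<delta>\<^sup>2 = - (r * X)"
      by (auto simp: a_def c_def r_def X_def field_simps)
    have m: "- multiplier \<delta> \<beta> \<nu> = r * F (r * X)"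
      unfolding multiplier_def bc hyp2F3_eq_power_series F_def by (simp add: r_def)
    have "K * (r * X) powr \<theta> \<le> r * X * F (r * X)"
      using r X by (intro K) simp
    moreover have "((X / 2) * (1 + r)) powr \<theta> \<le> (r * X) powr \<theta>"
      using r X \<theta> by (intro powr_mono2) (auto simp: field_simps)
    ultimately have "K * ((X / 2) * (1 + r)) powr \<theta> \<le> r * X * F (r * X)"
      using K(1) by (meson mult_left_mono less_imp_le order_trans)
    then have "L * (1 + r) powr \<theta> \<le> r * F (r * X)"
      using X r by (subst (asm) powr_mult) (auto simp: L_def field_simps)
    then show "- multiplier \<delta> \<beta> \<nu> \<ge> L * (1 + (norm \<nu>)\<^sup>2) powr (max 0 ((\<beta> - real CARD('n)) / 2))"
      unfolding m \<theta>_def[symmetric] by (simp add: r_def)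
  qed
qed

section \<open>Fourier coefficients of test functions\<close>

lemma axis_eq_scaleR: "axis i (x::real) = x *\<^sub>R axis i 1"
  by (simp add: vec_eq_iff axis_def)

text \<open>The box from 0 to \<open>b + v\<close> is cut in two ways. Cutting at height
  \<open>h\<close> leaves a bottom slab and the shifted torus; cutting at \<open>2 * pi\<close>
  leaves the torus and a top slab. The slabs differ by a full period and have equal
  integrals.\<close>

lemma integral_torus_shift:
  fixes \<phi> :: "real ^ 'n::finite \<Rightarrow> complex"
  assumes cont: "continuous_on UNIV \<phi>"
    and per: "\<And>x. \<phi> (x + axis i (2 * pi)) = \<phi> x"
    and h: "0 \<le> h" "h \<le> 2 * pi"
  shows "integral torus (\<lambda>x. \<phi> (x + axis i h)) = integral torus \<phi>"
proof -
  define b :: "real ^ 'n" where "b = (\<chi> i. 2 * pi)"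
  define v :: "real ^ 'n" where "v = axis i h"
  define w :: "real ^ 'n" where "w = axis i (2 * pi)"
  define u :: "real ^ 'n" where "u = (\<chi> j. if j = i then h else 2 * pi)"
  have int: "\<phi> integrable_on cbox p q" for p q
    by (rule integrable_continuous[OF continuous_on_subset[OF cont]]) simp
  have e: "axis i 1 \<in> (Basis :: (real ^ 'n) set)" by simp
  have split: "integral (cbox 0 (b + v)) \<phi> =
      integral (cbox 0 (b + v) \<inter> {x. x $ i \<le> r}) \<phi> + integral (cbox 0 (b + v) \<inter> {x. x $ i \<ge> r}) \<phi>" for r
    using integral_split[OF int e, of 0 "b + v" r] by (simp add: inner_axis)
  have 1: "cbox 0 (b + v) \<inter> {x. x $ i \<le> h} = cbox 0 u"
    using h by (auto simp: mem_box_cart b_def v_def u_def axis_def split: if_splits)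
      (smt (verit) pi_ge_zero)+
  have 2: "cbox 0 (b + v) \<inter> {x. x $ i \<ge> h} = cbox v (b + v)"
  proof (intro set_eqI iffI)
    fix x assume x: "x \<in> cbox 0 (b + v) \<inter> {x. x $ i \<ge> h}"
    then show "x \<in> cbox v (b + v)" by (auto simp: mem_box_cart v_def axis_def)
  next
    fix x assume x: "x \<in> cbox v (b + v)"
    then have "v $ j \<le> x $ j" for j by (simp add: mem_box_cart)
    moreover have "v $ j \<ge> 0" for j using h by (simp add: v_def axis_def)
    ultimately have "0 \<le> x $ j" for j using order_trans by blast
    moreover have "h \<le> x $ i" using \<open>v $ i \<le> x $ i\<close> by (simp add: v_def)
    ultimately show "x \<in> cbox 0 (b + v) \<inter> {x. x $ i \<ge> h}"
      using x by (simp add: mem_box_cart)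
  qed
  have 3: "cbox 0 (b + v) \<inter> {x. x $ i \<le> 2 * pi} = cbox 0 b"
    using h by (auto simp: mem_box_cart b_def v_def axis_def split: if_splits)
      (smt (verit) pi_ge_zero)+
  have 4: "cbox 0 (b + v) \<inter> {x. x $ i \<ge> 2 * pi} = cbox w (u + w)"
  proof -
    have "b + v = u + w"
      by (simp add: vec_eq_iff b_def v_def u_def w_def axis_def)
    moreover have "0 \<le> x $ j" if "\<And>j. w $ j \<le> x $ j" for x :: "real ^ 'n" and j
    proof -
      have "0 \<le> w $ j" by (simp add: w_def axis_def)
      then show ?thesis using that order_trans by blast
    qed
    ultimately show ?thesis
      by (auto simp: mem_box_cart w_def axis_def split: if_splits)
  qed
  have "integral (cbox 0 u) (\<phi> \<circ> (+) w) = integral (cbox w (u + w)) \<phi>"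
    using integral_shift_cbox_plus[of 0 u \<phi> w] by simp
  moreover have "\<phi> \<circ> (+) w = \<phi>" using per by (auto simp: w_def o_def add.commute)
  ultimately have "integral (cbox v (b + v)) \<phi> = integral (cbox 0 b) \<phi>"
    using split[of h] split[of "2 * pi"] unfolding 1 2 3 4 by simp
  moreover have "integral (cbox v (b + v)) \<phi> = integral (cbox 0 b) (\<lambda>x. \<phi> (x + v))"
    using integral_shift_cbox_plus[of 0 b \<phi> v] by (simp add: o_def add.commute)
  ultimately show ?thesis by (simp add: torus_def b_def v_def)
qed

text \<open>The integral of the translate by \<open>h\<close> is constant in \<open>h\<close>, and
  differentiation under the integral sign identifies its derivative at 0. The derivative is
  one-sided, since translations are controlled for \<open>0 \<le> h \<le> 2 * pi\<close>.\<close>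

lemma integral_torus_partial_deriv:
  fixes \<phi> :: "real ^ 'n::finite \<Rightarrow> complex"
  assumes diff: "\<And>x. \<phi> differentiable (at x)"
    and cont': "continuous_on UNIV (partial_deriv i \<phi>)"
    and per: "\<And>x. \<phi> (x + axis i (2 * pi)) = \<phi> x"
  shows "integral torus (partial_deriv i \<phi>) = 0"
proof -
  have cont: "continuous_on UNIV \<phi>"
    using diff differentiable_imp_continuous_within by (auto simp: continuous_on_eq_continuous_within)
  define I where "I = (\<lambda>h. integral torus (\<lambda>x. \<phi> (x + axis i h)))"
  have "(I has_vector_derivative integral torus (\<lambda>x. partial_deriv i \<phi> (x + axis i 0)))
      (at 0 within {0..2 * pi})"
    unfolding I_def torus_def
  proof (rule leibniz_rule_vector_derivative)
    fix h and x :: "real ^ 'n"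
    have D: "(\<phi> has_derivative frechet_derivative \<phi> (at (x + axis i h))) (at (x + axis i h))"
      using diff frechet_derivative_works by blast
    have lin: "linear (frechet_derivative \<phi> (at (x + axis i h)))"
      using D has_derivative_linear by blast
    have "((\<lambda>h. x + axis i h) has_derivative (\<lambda>h. axis i h)) (at h within {0..2 * pi})"
      by (subst (1 2) axis_eq_scaleR) (auto intro!: derivative_eq_intros)
    from has_derivative_compose[OF this D]
    have "((\<lambda>h. \<phi> (x + axis i h)) has_derivative
        (\<lambda>y. frechet_derivative \<phi> (at (x + axis i h)) (axis i y))) (at h within {0..2 * pi})" .
    then show "((\<lambda>h. \<phi> (x + axis i h)) has_vector_derivative partial_deriv i \<phi> (x + axis i h))
        (at h within {0..2 * pi})"
      unfolding has_vector_derivative_def partial_deriv_def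
      by (subst (asm) axis_eq_scaleR) (simp add: linear_scale[OF lin])
  next
    fix h :: real
    show "(\<lambda>x. \<phi> (x + axis i h)) integrable_on cbox 0 (\<chi> i. 2 * pi)"
      by (intro integrable_continuous continuous_intros continuous_on_compose2[OF cont]) auto
  next
    show "continuous_on ({0..2 * pi} \<times> cbox 0 (\<chi> i. 2 * pi)) (\<lambda>(h, x). partial_deriv i \<phi> (x + axis i h))"
      unfolding case_prod_unfold
      by (subst axis_eq_scaleR) (intro continuous_intros continuous_on_compose2[OF cont'], auto)
  qed auto
  moreover have "(I has_vector_derivative 0) (at 0 within {0..2 * pi})"
  proof (rule has_vector_derivative_transform)
    show "((\<lambda>h. integral torus \<phi>) has_vector_derivative 0) (at 0 within {0..2 * pi})"
      by (rule has_vector_derivative_const)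
  qed (use integral_torus_shift[OF cont per] in \<open>auto simp: I_def\<close>)
  ultimately have "integral torus (\<lambda>x. partial_deriv i \<phi> (x + axis i 0)) = 0"
    using vector_derivative_unique_within_closed_interval[of 0 "2 * pi" 0 I]
    by (metis cbox_interval atLeastAtMost_iff order_refl pi_gt_zero mult_pos_pos zero_less_numeral less_imp_le)
  moreover have "axis i 0 = (0 :: real ^ 'n)" by (simp add: axis_eq_0_iff)
  ultimately show ?thesis by simp
qed

section \<open>Test functions and their seminorms\<close>

lemma test_functions_periodic: "\<phi> \<in> test_functions \<Longrightarrow> \<phi> (x + axis i (2 * pi)) = \<phi> x"
  by (simp add: test_functions_def)

lemma test_functions_differentiable: "\<phi> \<in> test_functions \<Longrightarrow> \<phi> differentiable (at x)"
  unfolding test_functions_def by (auto dest: spec[of _ "[]"])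

lemma test_functions_continuous_on: "\<phi> \<in> test_functions \<Longrightarrow> continuous_on A \<phi>"
  using test_functions_differentiable differentiable_imp_continuous_within
  by (metis continuous_on_eq_continuous_within continuous_within_subset subset_UNIV)

lemma partial_deriv_in_test_functions:
  assumes "\<phi> \<in> test_functions"
  shows "partial_deriv i \<phi> \<in> test_functions"
proof -
  have "iter_partial is (partial_deriv i \<phi>) differentiable (at x)" for "is" x
  proof -
    \<comment> \<open>\<open>foldr\<close> applies the last entry first, so an initial derivative is
      appended at the end of the list.\<close>
    have "iter_partial (is @ [i]) \<phi> differentiable (at x)"
      using assms unfolding test_functions_def by blast
    then show ?thesis by simp
  qed
  moreover have "partial_deriv i \<phi> (x + axis j (2 * pi)) = partial_deriv i \<phi> x" for j x
  proof -
    let ?p = "axis j (2 * pi)"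
    have "(\<phi> has_derivative frechet_derivative \<phi> (at (x + ?p))) (at (x + ?p))"
      using test_functions_differentiable[OF assms] frechet_derivative_works by blast
    moreover have "((\<lambda>x. x + ?p) has_derivative (\<lambda>h. h)) (at x)"
      by (auto intro!: derivative_eq_intros)
    \<comment> \<open>By periodicity the derivative at \<open>x + ?p\<close> is also one at
      \<open>x\<close>, and derivatives are unique.\<close>
    ultimately have "((\<lambda>x. \<phi> (x + ?p)) has_derivative frechet_derivative \<phi> (at (x + ?p))) (at x)"
      using has_derivative_compose[of "\<lambda>x. x + ?p"] by fastforce
    then have "(\<phi> has_derivative frechet_derivative \<phi> (at (x + ?p))) (at x)"
      by (simp add: test_functions_periodic[OF assms])
    then show ?thesis
      unfolding partial_deriv_def using frechet_derivative_at by metis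
  qed
  ultimately show ?thesis by (simp add: test_functions_def)
qed

lemma iter_partial_in_test_functions:
  "\<phi> \<in> test_functions \<Longrightarrow> iter_partial is \<phi> \<in> test_functions"
  by (induction "is") (auto intro: partial_deriv_in_test_functions)

lemma test_functions_periodic_int:
  assumes "\<phi> \<in> test_functions"
  shows "\<phi> (x + axis i (2 * pi * of_int m)) = \<phi> x"
proof -
  have nat: "\<phi> (x + axis i (2 * pi * of_nat n)) = \<phi> x" for n x
  proof (induction n)
    case (Suc n)
    have "x + axis i (2 * pi * of_nat (Suc n)) = (x + axis i (2 * pi * of_nat n)) + axis i (2 * pi)"
      by (simp add: vec_eq_iff axis_def algebra_simps)
    then show ?case using Suc test_functions_periodic[OF assms] by metis
  qed (simp add: axis_eq_0_iff[THEN iffD2])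
  show ?thesis
  proof (cases m)
    case (nonneg n)
    then show ?thesis using nat[of x n] by simp
  next
    case (neg n)
    have "x + axis i (2 * pi * of_int m) + axis i (2 * pi * of_nat (Suc n)) = x"
      by (simp add: vec_eq_iff axis_def neg algebra_simps)
    then show ?thesis using nat[of "x + axis i (2 * pi * of_int m)" "Suc n"] by metis
  qed
qed

text \<open>Coordinates are moved into the period interval one at a time, by induction on the set of
  those already reduced.\<close>

lemma test_functions_reduce_torus:
  assumes "\<phi> \<in> test_functions"
  obtains y where "y \<in> torus" "\<phi> y = \<phi> x"
proof -
  have "\<exists>y. \<phi> y = \<phi> x \<and> (\<forall>i\<in>S. 0 \<le> y $ i \<and> y $ i \<le> 2 * pi)" if "finite S" for S
    using that
  proof (induction S)
    case (insert i S)
    then obtain y where y: "\<phi> y = \<phi> x" "\<forall>i\<in>S. 0 \<le> y $ i \<and> y $ i \<le> 2 * pi" by blast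
    define m where "m = - \<lfloor>y $ i / (2 * pi)\<rfloor>"
    define z where "z = y + axis i (2 * pi * of_int m)"
    have zj: "z $ j = y $ j" if "j \<noteq> i" for j using that by (simp add: z_def axis_def)
    have "z $ i = 2 * pi * (y $ i / (2 * pi) - of_int \<lfloor>y $ i / (2 * pi)\<rfloor>)"
      by (simp add: z_def m_def algebra_simps)
    moreover have "0 \<le> r - of_int \<lfloor>r\<rfloor>" "r - of_int \<lfloor>r\<rfloor> \<le> 1" for r :: real
      by linarith+
    ultimately have "0 \<le> z $ i" "z $ i \<le> 2 * pi"
      using mult_left_mono[of _ 1 "2 * pi"] by auto
    moreover have "\<phi> z = \<phi> x" unfolding z_def using test_functions_periodic_int[OF assms] y by metis
    ultimately show ?case using y zj by (metis insert_iff)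
  qed auto
  from this[of UNIV] that show ?thesis by (auto simp: torus_def mem_box_cart)
qed

text \<open>Periodicity reduces the supremum to the compact torus. This makes the suprema in the
  continuity estimate genuine.\<close>

lemma bdd_above_norm_test_function:
  assumes "\<phi> \<in> test_functions"
  shows "bdd_above (range (\<lambda>x. norm (\<phi> x)))"
proof -
  have "compact (\<phi> ` torus)"
    unfolding torus_def by (intro compact_continuous_image test_functions_continuous_on assms compact_cbox)
  then obtain B where B: "\<And>x. x \<in> torus \<Longrightarrow> norm (\<phi> x) \<le> B"
    by (meson compact_imp_bounded bounded_iff imageI)
  show ?thesis
  proof (rule bdd_aboveI2)
    fix x show "norm (\<phi> x) \<le> B"
      using test_functions_reduce_torus[OF assms, of x] B by metis
  qed
qed

definition seminorm :: "nat \<Rightarrow> (real ^ 'n::finite \<Rightarrow> complex) \<Rightarrow> real" where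
  "seminorm N \<phi> = (\<Sum>is | length is \<le> N. SUP x. norm (iter_partial is \<phi> x))"

lemma SUP_norm_nonneg:
  assumes "\<phi> \<in> test_functions"
  shows "0 \<le> (SUP x. norm (\<phi> x))"
  using cSUP_upper[OF UNIV_I bdd_above_norm_test_function[OF assms]] norm_ge_zero order_trans by blast

lemma SUP_le_seminorm:
  fixes \<phi> :: "real ^ 'n::finite \<Rightarrow> complex"
  assumes "\<phi> \<in> test_functions" "length is \<le> N"
  shows "(SUP x. norm (iter_partial is \<phi> x)) \<le> seminorm N \<phi>"
  unfolding seminorm_def
proof (rule member_le_sum)
  show "finite {is :: 'n list. length is \<le> N}"
    using finite_lists_length_le[of "UNIV :: 'n set" N] by simp
qed (use assms iter_partial_in_test_functions SUP_norm_nonneg in auto)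

section \<open>Characters and their orthogonality\<close>

lemma norm_fourier_char [simp]: "norm (fourier_char k x) = 1"
  by (simp add: fourier_char_def)

lemma continuous_on_fourier_char [continuous_intros]:
  "continuous_on A (fourier_char k)"
  unfolding fourier_char_def[abs_def] by (intro continuous_intros)

lemma has_derivative_fourier_char:
  "(fourier_char k has_derivative (\<lambda>v. (lattice_vec k \<bullet> v) *\<^sub>R (\<i> * fourier_char k x))) (at x)"
  unfolding fourier_char_def[abs_def] by (auto intro!: derivative_eq_intros)

lemma fourier_char_periodic: "fourier_char k (x + axis i (2 * pi)) = fourier_char k x"
proof -
  have "fourier_char k (x + axis i (2 * pi)) = fourier_char k x * cis (2 * pi * of_int (k $ i))"
    by (simp add: fourier_char_def inner_add_right inner_axis lattice_vec_def cis_mult mult.commute)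
  then show ?thesis by (simp add: cis_multiple_2pi)
qed

lemma fourier_char_0 [simp]: "fourier_char 0 = (\<lambda>x. 1)"
  by (rule ext) (simp add: fourier_char_def lattice_vec_def inner_vec_def)

lemma fourier_char_add: "fourier_char (k + l) x = fourier_char k x * fourier_char l x"
proof -
  have "lattice_vec (k + l) = lattice_vec k + lattice_vec l"
    by (simp add: lattice_vec_def vec_eq_iff)
  then show ?thesis by (simp add: fourier_char_def inner_add_left cis_mult)
qed

lemma frechet_derivative_eqI: "(f has_derivative f') (at x) \<Longrightarrow> frechet_derivative f (at x) = f'"
  using frechet_derivative_at by metis

lemma partial_deriv_fourier_char:
  "partial_deriv i (fourier_char k) x = \<i> * of_int (k $ i) * fourier_char k x"
  unfolding partial_deriv_def frechet_derivative_eqI[OF has_derivative_fourier_char]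
  by (simp add: inner_axis lattice_vec_def scaleR_conv_of_real)

lemma content_torus: "measure lborel (torus :: (real ^ 'n::finite) set) = (2 * pi) ^ CARD('n)"
  unfolding torus_def by (subst content_cbox_cart) (auto simp: interval_eq_empty_cart not_less)

text \<open>For \<open>k \<noteq> 0\<close> the character is a multiple of its own partial
  derivative in a direction with \<open>k $ i \<noteq> 0\<close>, and that derivative has integral
  zero.\<close>

lemma integral_torus_fourier_char:
  "integral torus (fourier_char k :: real ^ 'n::finite \<Rightarrow> complex) = (if k = 0 then (2 * pi) ^ CARD('n) else 0)"
proof (cases "k = 0")
  case True
  have "integral torus (\<lambda>x :: real ^ 'n. 1 :: complex) = of_real (measure lborel (torus :: (real ^ 'n) set))"
    unfolding torus_def by (subst integral_const) (simp add: scaleR_conv_of_real)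
  then show ?thesis using True by (simp add: content_torus)
next
  case False
  then obtain i where i: "k $ i \<noteq> 0" by (auto simp: vec_eq_iff)
  have eq: "partial_deriv i (fourier_char k) = (\<lambda>x. \<i> * of_int (k $ i) * fourier_char k x)"
    by (intro ext partial_deriv_fourier_char)
  have "integral torus (partial_deriv i (fourier_char k)) = 0"
    by (intro integral_torus_partial_deriv fourier_char_periodic)
      (auto simp: eq intro!: continuous_intros differentiableI has_derivative_fourier_char)
  then show ?thesis using False i by (simp add: eq)
qed

lemma regular_distr_fourier_char_orthogonal:
  "regular_distr (fourier_char k) (fourier_char (- l) :: real ^ 'n::finite \<Rightarrow> complex) =
     (if k = l then (2 * pi) ^ CARD('n) else 0)"
  using integral_torus_fourier_char[of "k - l"] fourier_char_add[of k "- l", symmetric]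
  by (simp add: regular_distr_def)

section \<open>Rapid decay of the pairings with test functions\<close>

lemma norm_regular_distr_fourier_char_le:
  fixes \<phi> :: "real ^ 'n::finite \<Rightarrow> complex"
  assumes "\<phi> \<in> test_functions"
  shows "norm (regular_distr (fourier_char k) \<phi>) \<le> (2 * pi) ^ CARD('n) * (SUP x. norm (\<phi> x))"
proof -
  have "(\<lambda>x. fourier_char k x * \<phi> x) integrable_on torus"
    unfolding torus_def
    by (intro integrable_continuous continuous_intros test_functions_continuous_on assms)
  then have "norm (regular_distr (fourier_char k) \<phi>) \<le> (SUP x. norm (\<phi> x)) * measure lborel (torus :: (real ^ 'n) set)"
    unfolding regular_distr_def torus_def using SUP_norm_nonneg[OF assms]
    by (intro has_integral_bound[OF _ integrable_integral])
      (auto simp: norm_mult intro!: cSUP_upper bdd_above_norm_test_function assms)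
  then show ?thesis by (simp add: content_torus mult.commute)
qed

text \<open>Integration by parts: the product is periodic, so its partial derivative has integral
  zero and no boundary term appears.\<close>

lemma regular_distr_fourier_char_partial_deriv:
  assumes \<phi>: "\<phi> \<in> test_functions"
  shows "regular_distr (fourier_char k) (partial_deriv i \<phi>) = - \<i> * of_int (k $ i) * regular_distr (fourier_char k) \<phi>"
proof -
  have D: "((\<lambda>x. fourier_char k x * \<phi> x) has_derivative
      (\<lambda>v. fourier_char k x * frechet_derivative \<phi> (at x) v
        + (lattice_vec k \<bullet> v) *\<^sub>R (\<i> * fourier_char k x) * \<phi> x)) (at x)" for x
    using has_derivative_mult[OF has_derivative_fourier_char[of k x]]
      test_functions_differentiable[OF \<phi>, of x] frechet_derivative_works by blast
  have eq: "partial_deriv i (\<lambda>x. fourier_char k x * \<phi> x) =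
      (\<lambda>x. fourier_char k x * partial_deriv i \<phi> x + \<i> * of_int (k $ i) * (fourier_char k x * \<phi> x))"
    unfolding partial_deriv_def[of _ "\<lambda>x. fourier_char k x * \<phi> x"] frechet_derivative_eqI[OF D]
    by (auto simp: partial_deriv_def inner_axis lattice_vec_def scaleR_conv_of_real)
  note cont = continuous_intros test_functions_continuous_on \<phi> partial_deriv_in_test_functions
  have int: "(\<lambda>x. fourier_char k x * partial_deriv i \<phi> x) integrable_on torus"
    "(\<lambda>x. \<i> * of_int (k $ i) * (fourier_char k x * \<phi> x)) integrable_on torus"
    unfolding torus_def by (intro integrable_continuous cont)+
  have "integral torus (partial_deriv i (\<lambda>x. fourier_char k x * \<phi> x)) = 0"
  proof (rule integral_torus_partial_deriv)
    show "(\<lambda>x. fourier_char k x * \<phi> x) differentiable (at x)" for x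
      using D by (rule differentiableI)
    show "continuous_on UNIV (partial_deriv i (\<lambda>x. fourier_char k x * \<phi> x))"
      unfolding eq by (intro cont)
  qed (simp add: fourier_char_periodic test_functions_periodic[OF \<phi>])
  then have "regular_distr (fourier_char k) (partial_deriv i \<phi>)
      + \<i> * of_int (k $ i) * regular_distr (fourier_char k) \<phi> = 0"
    unfolding eq regular_distr_def integral_add[OF int] by simp
  then show ?thesis by (simp add: add_eq_0_iff)
qed

lemma norm_regular_distr_iter_partial:
  assumes "\<phi> \<in> test_functions"
  shows "norm (regular_distr (fourier_char k) (iter_partial (replicate N i) \<phi>))
    = \<bar>real_of_int (k $ i)\<bar> ^ N * norm (regular_distr (fourier_char k) \<phi>)"
proof (induction N)
  case (Suc N)
  have "norm (regular_distr (fourier_char k) (iter_partial (replicate (Suc N) i) \<phi>))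
      = \<bar>real_of_int (k $ i)\<bar> * norm (regular_distr (fourier_char k) (iter_partial (replicate N i) \<phi>))"
    using regular_distr_fourier_char_partial_deriv[OF iter_partial_in_test_functions[OF assms], of k i "replicate N i"]
    by (simp add: norm_mult)
  also note Suc.IH
  finally show ?case by simp
qed simp

definition weight :: "int ^ 'n::finite \<Rightarrow> real" where
  "weight k = 1 + (norm (lattice_vec k))\<^sup>2"

lemma weight_eq: "weight k = 1 + (\<Sum>i\<in>UNIV. (real_of_int (k $ i))\<^sup>2)"
  unfolding weight_def by (simp add: norm_vec_def L2_set_def lattice_vec_def sum_nonneg)

lemma weight_ge_1: "weight k \<ge> 1" and weight_pos: "weight k > 0"
  by (simp_all add: weight_def add_pos_nonneg)

text \<open>A factor \<open>\<bar>k $ i\<bar>\<close> is paid for by one derivative in direction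
  \<open>i\<close>. The coordinate of largest modulus dominates the weight, so \<open>2 * M\<close>
  derivatives in that one direction suffice.\<close>

lemma regular_distr_fourier_char_decay:
  fixes \<phi> :: "real ^ 'n::finite \<Rightarrow> complex"
  assumes \<phi>: "\<phi> \<in> test_functions"
  shows "weight k ^ M * norm (regular_distr (fourier_char k) \<phi>)
    \<le> (1 + real CARD('n)) ^ M * (2 * pi) ^ CARD('n) * seminorm (2 * M) \<phi>"
proof -
  let ?J = "norm (regular_distr (fourier_char k) \<phi>)"
  have bound: "\<bar>real_of_int (k $ i)\<bar> ^ N * ?J \<le> (2 * pi) ^ CARD('n) * seminorm (2 * M) \<phi>"
    if "N \<le> 2 * M" for N i
  proof -
    have "\<bar>real_of_int (k $ i)\<bar> ^ N * ?J
        \<le> (2 * pi) ^ CARD('n) * (SUP x. norm (iter_partial (replicate N i) \<phi> x))"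
      unfolding norm_regular_distr_iter_partial[OF \<phi>, symmetric]
      by (intro norm_regular_distr_fourier_char_le iter_partial_in_test_functions \<phi>)
    also have "\<dots> \<le> (2 * pi) ^ CARD('n) * seminorm (2 * M) \<phi>"
      using that by (intro mult_left_mono SUP_le_seminorm \<phi>) auto
    finally show ?thesis .
  qed
  define m where "m = Max (range (\<lambda>i. \<bar>k $ i\<bar>))"
  have "m \<in> range (\<lambda>i. \<bar>k $ i\<bar>)" unfolding m_def by (intro Max_in) auto
  then obtain i where i: "m = \<bar>k $ i\<bar>" by blast
  have m: "\<bar>k $ j\<bar> \<le> m" for j unfolding m_def by (intro Max_ge) auto
  define r where "r = real_of_int \<bar>k $ i\<bar>"
  have r: "(real_of_int (k $ j))\<^sup>2 \<le> r\<^sup>2" for j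
    using m[of j] unfolding r_def i[symmetric] by (metis abs_le_square_iff abs_of_nonneg of_int_abs of_int_le_iff abs_ge_zero order_trans of_int_0_le_iff)
  have "(\<Sum>j\<in>UNIV. (real_of_int (k $ j))\<^sup>2) \<le> (\<Sum>j\<in>(UNIV :: 'n set). r\<^sup>2)"
    by (intro sum_mono r)
  then have w: "weight k \<le> 1 + real CARD('n) * r\<^sup>2" by (simp add: weight_eq)
  show ?thesis
  proof (cases "k $ i = 0")
    case True
    then have "weight k = 1" using w weight_ge_1[of k] by (simp add: r_def)
    moreover have "1 * ?J \<le> (1 + real CARD('n)) ^ M * ((2 * pi) ^ CARD('n) * seminorm (2 * M) \<phi>)"
      using bound[of 0] by (intro mult_mono) auto
    ultimately show ?thesis by (simp add: mult.assoc)
  next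
    case False
    then have "r \<ge> 1" unfolding r_def by linarith
    then have "1 \<le> r\<^sup>2" by simp
    with w have "weight k \<le> (1 + real CARD('n)) * r\<^sup>2" by (simp add: algebra_simps)
    then have "weight k ^ M \<le> ((1 + real CARD('n)) * r\<^sup>2) ^ M"
      using weight_pos[of k] by (intro power_mono) auto
    then have "weight k ^ M * ?J \<le> ((1 + real CARD('n)) * r\<^sup>2) ^ M * ?J"
      by (intro mult_right_mono) auto
    also have "\<dots> = (1 + real CARD('n)) ^ M * (\<bar>real_of_int (k $ i)\<bar> ^ (2 * M) * ?J)"
      by (simp add: power_mult_distrib power_mult r_def)
    also have "\<dots> \<le> (1 + real CARD('n)) ^ M * ((2 * pi) ^ CARD('n) * seminorm (2 * M) \<phi>)"
      by (intro mult_left_mono bound) auto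
    finally show ?thesis by (simp add: mult.assoc)
  qed
qed

section \<open>Summability over the lattice\<close>

lemma summable_on_inverse_square_int: "(\<lambda>m::int. 1 / (1 + (real_of_int m)\<^sup>2)) summable_on UNIV"
proof -
  let ?w = "\<lambda>m::int. 1 / (1 + (real_of_int m)\<^sup>2)"
  have "summable (\<lambda>n::nat. 1 / (1 + (real n)\<^sup>2))"
  proof (rule summable_comparison_test'[OF inverse_power_summable[of 2, where 'a = real]])
    fix n :: nat assume "n \<ge> 1"
    then have "1 / (1 + (real n)\<^sup>2) \<le> 1 / (real n)\<^sup>2"
      by (intro divide_left_mono) (auto simp: add_pos_nonneg)
    then show "norm (1 / (1 + (real n)\<^sup>2)) \<le> inverse (real n ^ 2)"
      by (simp add: inverse_eq_divide)
  qed simp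
  then have *: "(\<lambda>n::nat. 1 / (1 + (real n)\<^sup>2)) summable_on UNIV"
    by (subst summable_on_UNIV_nonneg_real_iff) auto
  have "?w summable_on range int" "?w summable_on range (\<lambda>n. - int n)"
    using * by (subst summable_on_reindex; simp add: o_def inj_def)+
  then have "?w summable_on (range int \<union> range (\<lambda>n. - int n))" by (rule summable_on_union)
  moreover have "range int \<union> range (\<lambda>n. - int n) = UNIV"
  proof -
    have "m \<in> range int \<union> range (\<lambda>n. - int n)" for m
      by (cases m rule: int_cases2) auto
    then show ?thesis by blast
  qed
  ultimately show ?thesis by simp
qed

text \<open>The weight dominates \<open>1 + k_i^2\<close> for each of the \<open>n\<close>
  coordinates, so its inverse \<open>n\<close>-th power is at most a product of one-dimensional
  terms, whose sums factor.\<close>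

lemma summable_on_weight: "(\<lambda>k :: int ^ 'n::finite. 1 / weight k ^ CARD('n)) summable_on UNIV"
proof (rule nonneg_bdd_above_summable_on)
  show "0 \<le> 1 / weight k ^ CARD('n)" for k :: "int ^ 'n" using weight_pos[of k] by simp
  let ?w = "\<lambda>m::int. 1 / (1 + (real_of_int m)\<^sup>2)"
  define S where "S = infsum ?w UNIV"
  show "bdd_above (sum (\<lambda>k :: int ^ 'n. 1 / weight k ^ CARD('n)) ` {F. F \<subseteq> UNIV \<and> finite F})"
  proof (rule bdd_aboveI2)
    fix F :: "(int ^ 'n) set" assume "F \<in> {F. F \<subseteq> UNIV \<and> finite F}"
    then have F: "finite F" by simp
    \<comment> \<open>All coordinates occurring in \<open>F\<close>; thus \<open>F\<close> embeds
      into the finite set of functions with values in \<open>A\<close>.\<close>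
    define A where "A = (\<Union>i. (\<lambda>k. k $ i) ` F)"
    have A: "finite A" using F by (simp add: A_def)
    have "(\<Sum>k\<in>F. 1 / weight k ^ CARD('n)) \<le> (\<Sum>k\<in>F. \<Prod>i\<in>UNIV. ?w (k $ i))"
    proof (rule sum_mono)
      fix k :: "int ^ 'n"
      have "(\<Prod>i\<in>(UNIV :: 'n set). 1 / weight k) \<le> (\<Prod>i\<in>UNIV. ?w (k $ i))"
      proof (intro prod_mono conjI divide_left_mono)
        fix i
        show "1 + (real_of_int (k $ i))\<^sup>2 \<le> weight k"
          unfolding weight_eq by (intro add_left_mono member_le_sum) auto
      qed (use weight_pos[of k] in \<open>auto simp: add_pos_nonneg\<close>)
      then show "1 / weight k ^ CARD('n) \<le> (\<Prod>i\<in>UNIV. ?w (k $ i))"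
        by (simp add: power_one_over)
    qed
    also have "\<dots> = (\<Sum>p\<in>vec_nth ` F. \<Prod>i\<in>UNIV. ?w (p i))"
      by (subst sum.reindex) (auto simp: inj_on_def vec_nth_inject)
    also have "\<dots> \<le> (\<Sum>p\<in>PiE (UNIV :: 'n set) (\<lambda>_. A). \<Prod>i\<in>UNIV. ?w (p i))"
      using A by (intro sum_mono2 finite_PiE) (auto simp: A_def intro!: prod_nonneg)
    also have "\<dots> = (\<Prod>i\<in>(UNIV :: 'n set). \<Sum>m\<in>A. ?w m)"
      using A by (intro prod_sum_PiE[symmetric]) auto
    also have "\<dots> \<le> (\<Prod>i\<in>(UNIV :: 'n set). S)"
      unfolding S_def using A
      by (intro prod_mono conjI sum_nonneg finite_sum_le_infsum summable_on_inverse_square_int) auto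
    finally show "(\<Sum>k\<in>F. 1 / weight k ^ CARD('n)) \<le> S ^ CARD('n)" by simp
  qed
qed


section \<open>Fourier series with slowly growing coefficients\<close>

text \<open>Polynomial growth is what the rapid decay of the pairings can absorb; coefficients from
  any Sobolev space have it.\<close>

locale slowly_growing =
  fixes a :: "int ^ 'n::finite \<Rightarrow> complex" and C :: real and M :: nat
  assumes growth: "norm (a k) \<le> C * weight k ^ M"
begin

definition K :: real where
  "K = C * ((1 + real CARD('n)) ^ (M + CARD('n)) * (2 * pi) ^ CARD('n))"

lemma C_nonneg: "C \<ge> 0"
proof -
  have "0 \<le> C * weight (0 :: int ^ 'n) ^ M" using growth norm_ge_zero order_trans by blast
  then show ?thesis by (simp add: zero_le_mult_iff weight_eq)
qed

text \<open>The decay is used with exponent \<open>M + CARD('n)\<close>: \<open>M\<close> powers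
  cancel the growth, the others leave a summable weight.\<close>

lemma norm_term_le:
  assumes "\<phi> \<in> test_functions"
  shows "norm (a k * regular_distr (fourier_char k) \<phi>)
    \<le> K * seminorm (2 * (M + CARD('n))) \<phi> * (1 / weight k ^ CARD('n))"
proof -
  let ?J = "norm (regular_distr (fourier_char k) \<phi>)" and ?w = "weight k"
  have w: "?w ^ CARD('n) > 0" using weight_pos[of k] by simp
  have "norm (a k) * ?J \<le> C * ?w ^ M * ?J"
    by (intro mult_right_mono growth) auto
  also have "\<dots> = C * (?w ^ (M + CARD('n)) * ?J) * (1 / ?w ^ CARD('n))"
    using w weight_pos[of k] by (simp add: power_add)
  also have "\<dots> \<le> C * ((1 + real CARD('n)) ^ (M + CARD('n)) * (2 * pi) ^ CARD('n)
      * seminorm (2 * (M + CARD('n))) \<phi>) * (1 / ?w ^ CARD('n))"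
    using w C_nonneg
    by (intro mult_right_mono mult_left_mono regular_distr_fourier_char_decay assms) auto
  finally show ?thesis by (simp add: K_def norm_mult mult.assoc)
qed

lemma abs_summable_terms:
  assumes "\<phi> \<in> test_functions"
  shows "(\<lambda>k. norm (a k * regular_distr (fourier_char k) \<phi>)) summable_on UNIV"
  by (rule Infinite_Sum.abs_summable_on_comparison_test'[OF _ norm_term_le[OF assms]])
    (rule summable_on_cmult_right[OF summable_on_weight])

lemma summable_terms:
  "\<phi> \<in> test_functions \<Longrightarrow> (\<lambda>k. a k * regular_distr (fourier_char k) \<phi>) summable_on UNIV"
  by (rule abs_summable_summable[OF abs_summable_terms])

lemma converges: "fourier_series_converges a"
  unfolding fourier_series_converges_def using summable_terms by blast

lemma norm_fourier_series_le:
  assumes "\<phi> \<in> test_functions"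
  shows "norm (fourier_series a \<phi>)
    \<le> K * infsum (\<lambda>k :: int ^ 'n. 1 / weight k ^ CARD('n)) UNIV * seminorm (2 * (M + CARD('n))) \<phi>"
proof -
  have "norm (fourier_series a \<phi>) \<le> (\<Sum>\<^sub>\<infinity>k. norm (a k * regular_distr (fourier_char k) \<phi>))"
    unfolding fourier_series_def by (rule norm_infsum_bound[OF abs_summable_terms[OF assms]])
  also have "\<dots> \<le> (\<Sum>\<^sub>\<infinity>k :: int ^ 'n. K * seminorm (2 * (M + CARD('n))) \<phi> * (1 / weight k ^ CARD('n)))"
    by (intro infsum_mono abs_summable_terms norm_term_le assms summable_on_cmult_right summable_on_weight)
  also have "\<dots> = K * seminorm (2 * (M + CARD('n))) \<phi> * infsum (\<lambda>k :: int ^ 'n. 1 / weight k ^ CARD('n)) UNIV"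
    by (rule infsum_cmult_right')
  finally show ?thesis by (simp add: mult_ac)
qed

lemma regular_distr_add:
  assumes "\<phi> \<in> test_functions" "\<psi> \<in> test_functions"
  shows "regular_distr (fourier_char k) (\<lambda>x. \<phi> x + \<psi> x)
    = regular_distr (fourier_char k) \<phi> + regular_distr (fourier_char k) \<psi>"
  unfolding regular_distr_def torus_def ring_distribs
  by (intro integral_add integrable_continuous continuous_intros test_functions_continuous_on assms)

lemma fourier_series_in_periodic_distributions: "fourier_series a \<in> periodic_distributions"
proof -
  have "fourier_series a (\<lambda>x. \<phi> x + \<psi> x) = fourier_series a \<phi> + fourier_series a \<psi>"
    if "\<phi> \<in> test_functions" "\<psi> \<in> test_functions" for \<phi> \<psi>
    using infsum_add[OF summable_terms[OF that(1)] summable_terms[OF that(2)]]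
    by (simp add: fourier_series_def regular_distr_add[OF that] ring_distribs)
  moreover have "fourier_series a (\<lambda>x. c * \<phi> x) = c * fourier_series a \<phi>"
    for c \<phi>
  proof -
    have "(\<lambda>k. a k * regular_distr (fourier_char k) (\<lambda>x. c * \<phi> x))
        = (\<lambda>k. c * (a k * regular_distr (fourier_char k) \<phi>))"
      unfolding regular_distr_def by (simp add: mult.left_commute)
    then show ?thesis by (simp only: fourier_series_def infsum_cmult_right')
  qed
  moreover have "\<exists>C N. \<forall>\<phi>\<in>test_functions. norm (fourier_series a \<phi>)
      \<le> C * (\<Sum>is | length is \<le> N. SUP x. norm (iter_partial is \<phi> x))"
    using norm_fourier_series_le unfolding seminorm_def by blast
  ultimately show ?thesis by (simp add: periodic_distributions_def)
qed

text \<open>By orthogonality only the term \<open>k = l\<close> survives.\<close>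

lemma fourier_coeff_fourier_series: "fourier_coeff (fourier_series a) l = a l"
proof -
  have "fourier_series a (fourier_char (- l))
      = (\<Sum>\<^sub>\<infinity>k\<in>{l}. a k * (2 * pi) ^ CARD('n))"
    unfolding fourier_series_def regular_distr_fourier_char_orthogonal
    by (intro infsum_cong_neutral) auto
  then show ?thesis by (simp add: fourier_coeff_def)
qed

end

section \<open>Sobolev regularity of Fourier series and of the wave\<close>

lemma weight_powr_le:
  fixes q :: real
  shows "weight k powr - q \<le> weight k ^ (2 * nat \<lceil>\<bar>q\<bar>\<rceil>)"
proof -
  have "- q \<le> real (2 * nat \<lceil>\<bar>q\<bar>\<rceil>)" by linarith
  then have "weight k powr - q \<le> weight k powr real (2 * nat \<lceil>\<bar>q\<bar>\<rceil>)"
    by (intro powr_mono weight_ge_1)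
  then show ?thesis by (simp only: powr_realpow[OF weight_pos])
qed

text \<open>Each term of a convergent nonnegative sum is bounded by the total \<open>B\<close>,
  which forces polynomial growth of \<open>a\<close>. As \<open>a\<close> is recovered as the
  Fourier coefficients, the assumed sum is the Sobolev sum of the series.\<close>

lemma fourier_series_in_sobolev:
  fixes a :: "int ^ 'n::finite \<Rightarrow> complex"
  assumes sum: "(\<lambda>k. weight k powr q * (norm (a k))\<^sup>2) summable_on UNIV"
  shows "fourier_series_converges a \<and> fourier_series a \<in> sobolev q"
proof -
  define B where "B = (\<Sum>\<^sub>\<infinity>k. weight k powr q * (norm (a k))\<^sup>2)"
  define M where "M = nat \<lceil>\<bar>q\<bar>\<rceil>"
  have B0: "B \<ge> 0" unfolding B_def by (intro infsum_nonneg) auto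
  interpret slowly_growing a "sqrt B" M
  proof
    fix k
    have "sum (\<lambda>k. weight k powr q * (norm (a k))\<^sup>2) {k} \<le> B"
      unfolding B_def by (intro finite_sum_le_infsum sum) auto
    then have le: "weight k powr q * (norm (a k))\<^sup>2 \<le> B" by simp
    have "(norm (a k))\<^sup>2 = weight k powr - q * (weight k powr q * (norm (a k))\<^sup>2)"
      using weight_pos[of k] by (simp add: powr_minus)
    \<comment> \<open>The even exponent makes the bound a square, so the square root can be
      taken.\<close>
    also have "\<dots> \<le> weight k ^ (2 * M) * B"
      unfolding M_def by (intro mult_mono weight_powr_le le) (use weight_pos[of k] in auto)
    also have "\<dots> = (sqrt B * weight k ^ M)\<^sup>2"
      using B0 by (simp add: power_mult_distrib power_mult[symmetric] mult.commute)
    finally show "norm (a k) \<le> sqrt B * weight k ^ M"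
      by (rule power2_le_imp_le) (use B0 weight_pos[of k] in auto)
  qed
  show ?thesis
    using converges fourier_series_in_periodic_distributions sum
    by (simp add: sobolev_def fourier_coeff_fourier_series weight_def)
qed

lemma norm_lattice_vec_ge_1:
  assumes "k \<noteq> 0"
  shows "norm (lattice_vec k) \<ge> 1"
proof -
  obtain i where "k $ i \<noteq> 0" using assms by (auto simp: vec_eq_iff)
  then have "1 \<le> \<bar>lattice_vec k $ i\<bar>" by (simp add: lattice_vec_def)
  then show ?thesis using component_le_norm_cart order_trans by blast
qed

lemma norm_add_power2_le:
  fixes x y :: complex
  assumes "norm x \<le> p" "norm y \<le> q"
  shows "(norm (x + y))\<^sup>2 \<le> 2 * p\<^sup>2 + 2 * q\<^sup>2"
proof -
  have "(norm (x + y))\<^sup>2 \<le> (p + q)\<^sup>2"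
    using norm_triangle_mono[OF assms] by (intro power_mono) auto
  also have "\<dots> \<le> 2 * p\<^sup>2 + 2 * q\<^sup>2"
    using zero_le_power2[of "p - q"] by (simp add: power2_eq_square algebra_simps)
  finally show ?thesis .
qed

text \<open>Convergence is asserted separately because \<open>infsum\<close> is 0 by default on
  families that are not summable.\<close>

theorem theorem5:
  fixes \<delta> \<beta> s1 s2 \<theta> s t :: real
    and f g :: "'n::finite functional"
  assumes "\<delta> > 0"
    and "\<beta> < real CARD('n) + 4"
    and "f \<in> sobolev s1"
    and "g \<in> sobolev s2"
    and "\<theta> = max 0 ((\<beta> - real CARD('n)) / 2)"
    and "s = min s1 (s2 + \<theta>)"
    and "t \<ge> 0"
  shows "fourier_series_converges (wave_coeff \<delta> \<beta> f g t) \<and> wave \<delta> \<beta> f g t \<in> sobolev s"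
proof -
  obtain K where K: "K > 0"
    "\<And>\<nu> :: real ^ 'n. norm \<nu> \<ge> 1 \<Longrightarrow> - multiplier \<delta> \<beta> \<nu> \<ge> K * (1 + (norm \<nu>)\<^sup>2) powr \<theta>"
    using multiplier_lower_bound[OF assms(1,2)] unfolding assms(5) by blast
  have f: "(\<lambda>k. weight k powr s1 * (norm (fourier_coeff f k))\<^sup>2) summable_on UNIV"
    and g: "(\<lambda>k. weight k powr s2 * (norm (fourier_coeff g k))\<^sup>2) summable_on UNIV"
    using assms(3,4) by (simp_all add: sobolev_def weight_def)
  \<comment> \<open>In \<open>?D\<close> the summand \<open>t^2\<close> serves the zero mode, which
    grows linearly in time, and \<open>1 / K\<close> serves all other modes.\<close>
  let ?a = "wave_coeff \<delta> \<beta> f g t" and ?D = "t\<^sup>2 + 1 / K"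
  have "weight k powr s * (norm (?a k))\<^sup>2
      \<le> 2 * (weight k powr s1 * (norm (fourier_coeff f k))\<^sup>2)
        + 2 * ?D * (weight k powr s2 * (norm (fourier_coeff g k))\<^sup>2)" for k
  proof (cases "k = 0")
    \<comment> \<open>At \<open>k = 0\<close> the weight is 1, so all its powers agree.\<close>
    case True
    have "(norm (?a k))\<^sup>2 \<le> 2 * (norm (fourier_coeff f k))\<^sup>2 + 2 * (norm (fourier_coeff g k) * t)\<^sup>2"
      using norm_add_power2_le[OF order_refl order_refl, of "fourier_coeff f 0" "fourier_coeff g 0 * of_real t"]
        True \<open>t \<ge> 0\<close> by (simp add: wave_coeff_def norm_mult)
    also have "\<dots> \<le> 2 * (norm (fourier_coeff f k))\<^sup>2 + 2 * ?D * (norm (fourier_coeff g k))\<^sup>2"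
      using K(1) by (simp add: power_mult_distrib algebra_simps)
    finally show ?thesis using True by (simp add: weight_eq)
  next
    case False
    let ?w = "weight k" and ?m = "- multiplier \<delta> \<beta> (lattice_vec k)"
    define \<omega> where "\<omega> = sqrt ?m"
    have w: "?w powr \<theta> > 0" using weight_pos[of k] by simp
    have m: "K * ?w powr \<theta> \<le> ?m"
      unfolding weight_def by (rule K(2)[OF norm_lattice_vec_ge_1[OF False]])
    \<comment> \<open>Positivity makes the frequency real and nonzero, so that dividing by
      \<open>\<omega>\<close> is meaningful and its square is \<open>?m\<close>.\<close>
    then have m0: "?m > 0" using mult_pos_pos[OF K(1) w] by linarith
    then have \<omega>: "\<omega> > 0" "\<omega>\<^sup>2 = ?m" by (simp_all add: \<omega>_def)
    have "norm (fourier_coeff f k * of_real (cos (\<omega> * t))) \<le> norm (fourier_coeff f k)"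
      unfolding norm_mult by (rule mult_left_le) auto
    moreover have "norm (fourier_coeff g k / of_real \<omega> * of_real (sin (\<omega> * t))) \<le> norm (fourier_coeff g k) / \<omega>"
    proof -
      have "norm (fourier_coeff g k / of_real \<omega> * of_real (sin (\<omega> * t)))
          \<le> norm (fourier_coeff g k / of_real \<omega>)"
        unfolding norm_mult by (rule mult_left_le) auto
      then show ?thesis using \<omega> by (simp add: norm_divide)
    qed
    ultimately have "(norm (?a k))\<^sup>2
        \<le> 2 * (norm (fourier_coeff f k))\<^sup>2 + 2 * (norm (fourier_coeff g k) / \<omega>)\<^sup>2"
      using False norm_add_power2_le by (simp add: wave_coeff_def Let_def \<omega>_def)
    then have "?w powr s * (norm (?a k))\<^sup>2 \<le> 2 * (?w powr s * (norm (fourier_coeff f k))\<^sup>2)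
        + 2 * (?w powr s * (norm (fourier_coeff g k) / \<omega>)\<^sup>2)"
      using mult_left_mono[of _ _ "?w powr s"] by (fastforce simp: algebra_simps)
    moreover have "?w powr s * (norm (fourier_coeff f k))\<^sup>2 \<le> ?w powr s1 * (norm (fourier_coeff f k))\<^sup>2"
      using assms(6) by (intro mult_right_mono powr_mono weight_ge_1) auto
    moreover have "?w powr s * (norm (fourier_coeff g k) / \<omega>)\<^sup>2
        \<le> ?D * (?w powr s2 * (norm (fourier_coeff g k))\<^sup>2)"
    proof -
      \<comment> \<open>The gain of \<open>\<theta>\<close>: the factor
        \<open>?w powr \<theta>\<close> cancels against the lower bound for \<open>?m\<close>, and
        \<open>?w powr s2\<close> remains.\<close>
      have "?w powr s \<le> ?w powr (s2 + \<theta>)"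
        using assms(6) by (intro powr_mono weight_ge_1) auto
      moreover have "1 / ?m \<le> 1 / (K * ?w powr \<theta>)"
        using m m0 K(1) w by (intro divide_left_mono mult_pos_pos) auto
      ultimately have "?w powr s * (1 / ?m) \<le> ?w powr (s2 + \<theta>) * (1 / (K * ?w powr \<theta>))"
        using m0 by (intro mult_mono) auto
      also have "\<dots> = 1 / K * ?w powr s2" using w by (simp add: powr_add)
      also have "\<dots> \<le> ?D * ?w powr s2" by (intro mult_right_mono) auto
      finally have "?w powr s * (1 / ?m) * (norm (fourier_coeff g k))\<^sup>2
          \<le> ?D * ?w powr s2 * (norm (fourier_coeff g k))\<^sup>2" by (intro mult_right_mono) auto
      then show ?thesis by (simp add: power_divide \<omega>(2))
    qed
    ultimately show ?thesis by linarith
  qed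
  then have "(\<lambda>k. weight k powr s * (norm (?a k))\<^sup>2) summable_on UNIV"
    by (intro summable_on_comparison_test[OF summable_on_add[OF summable_on_cmult_right[OF f]
        summable_on_cmult_right[OF g]]]) auto
  from fourier_series_in_sobolev[OF this] show ?thesis unfolding wave_def .
qed

end
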